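(* Let $p$ be a prime, let $A=\{\mathbf a_1,\dots,\mathbf a_N\}\subseteq\mathbb Z^n$, and let $\beta$, with $-\beta\in C(\Delta)$, be such that the finite set $$\Gamma=(-\sigma_{-\beta}^\circ)\cap(\beta+\mathbb Z^n)\cap RA$$ is nonempty. Let $B={\rm card}(\Gamma)$ and fix a positive integer $a$ such that $(p^a-1)\beta\in\mathbb Z^n$. Then there exist $\gamma\in\Gamma$, a positive integer $b\le B$, and $v\in R_{\gamma,ab}$ such that $$w(v)=w(R_{\gamma,ab})=w(R_\gamma)=\min\{w(R_\delta) : \delta\in\Gamma\}.$$ In particular, the series $\Phi_v(\lambda)$ has $p$-integral coefficients.
   Context: $\mathbb N$ = nonnegative integers. For $t\in\mathbb N$ with base-$p$ digits $t_j$ put $w_p(t)=\sum_j t_j$; for $s\in\mathbb N^N$ put $w_p(s)=\sum_{i=1}^N w_p(s_i)$. Let $R$ be the set of all $r=(r_1,\dots,r_N)\in(\mathbb Q\cap\mathbb Z_p)^N$ with $-1\le r_i\le0$ for all $i$. For $r\in R$ choose a positive integer $c$ with $(1-p^c)r\in\mathbb N^N$ and put $w(r)=w_p((1-p^c)r)/c$ (independent of the choice of $c$). Put $RA=\{\sum_{i=1}^N r_i\mathbf a_i : r\in R\}$. For $\gamma\in RA$ put $R_\gamma=\{r\in R:\sum_i r_i\mathbf a_i=\gamma\}$ and $w(R_\gamma)=\inf\{w(r):r\in R_\gamma\}$. For a positive integer $c$ put $R_{\gamma,c}=\{r\in R_\gamma : (1-p^c)r\in\mathbb N^N\}$ (a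 finite set) and $w(R_{\gamma,c})=\min\{w(r): r\in R_{\gamma,c}\}$ (equal to $+\infty$ if $R_{\gamma,c}=\emptyset$). Let $\Delta$ be the convex hull of $A\cup\{\mathbf0\}$ in $\mathbb R^n$ and $C(\Delta)$ the real cone generated by $\Delta$. Let $\sigma_{-\beta}$ be the smallest closed face of $C(\Delta)$ containing $-\beta$, and $\sigma_{-\beta}^\circ$ be $\sigma_{-\beta}$ minus the union of all its proper closed faces. Let $L=\{l\in\mathbb Z^N:\sum_i l_i\mathbf a_i=\mathbf0\}$, ${\rm nsupp}(v)=\{i: v_i\text{ is a negative integer}\}$, $L_v=\{l\in L:{\rm nsupp}(v+l)={\rm nsupp}(v)\}$, $[v]_{l_-}=\prod_{l_i<0}\prod_{j=1}^{-l_i}(v_i-j+1)$, $[v+l]_{l_+}=\prod_{l_i>0}\prod_{j=1}^{l_i}(v_i+j)$. Fix $\pi$ with $\pi^{p-1}=-p$ (in an algebraic closure of $\mathbb Q_p$) and put $$\Phi_v(\lambda)=\sum_{l\in L_v}\frac{[v]_{l_-}}{[v+l]_{l_+}}\pi^{\sum_{i=1}^N l_i}\lambda^{v+l}.$$ Its coefficients are the numbers $\frac{[v]_{l_-}}{[v+l]_{l_+}}\pi^{\sum l_i}$; "$p$-integral" means of nonnegative $p$-adic valuation. *)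

theory Defs
  imports "HOL-Analysis.Analysis" "HOL-Computational_Algebra.Primes"
begin

section \<open>Weights\<close>

definition digit_sum :: "nat \<Rightarrow> nat \<Rightarrow> nat" where
  "digit_sum p t = (\<Sum>j | t div p ^ j mod p \<noteq> 0. t div p ^ j mod p)"

definition digit_sum_vec :: "nat \<Rightarrow> nat ^ 'm \<Rightarrow> nat" where
  "digit_sum_vec p s = (\<Sum>i\<in>UNIV. digit_sum p (s $ i))"

text \<open>The ring of \<open>p\<close>-integral rational numbers, i.e. the intersection of the rationals with the
  \<open>p\<close>-adic integers.\<close>
definition p_integral_rats :: "nat \<Rightarrow> rat set" where
  "p_integral_rats p = {of_int x / of_int y | x y. \<not> int p dvd y}"

definition R_set :: "nat \<Rightarrow> (rat ^ 'm) set" where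
  "R_set p = {r. \<forall>i. r $ i \<in> p_integral_rats p \<and> -1 \<le> r $ i \<and> r $ i \<le> 0}"

text \<open>The condition that \<open>(1 - p\<^sup>c) r\<close> is a vector of nonnegative integers.\<close>
definition clears :: "nat \<Rightarrow> nat \<Rightarrow> rat ^ 'm \<Rightarrow> bool" where
  "clears p c r \<longleftrightarrow> (\<forall>i. (1 - of_nat p ^ c) * r $ i \<in> \<nat>)"

text \<open>The floor only serves to pass from rationals to naturals: under \<open>clears p c r\<close> the
  entries are already nonnegative integers.\<close>
definition cleared :: "nat \<Rightarrow> nat \<Rightarrow> rat ^ 'm \<Rightarrow> nat ^ 'm" where
  "cleared p c r = (\<chi> i. nat \<lfloor>(1 - of_nat p ^ c) * r $ i\<rfloor>)"

definition weight :: "nat \<Rightarrow> rat ^ 'm \<Rightarrow> real" where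
  "weight p r = (let c = (SOME c. 0 < c \<and> clears p c r)
     in real (digit_sum_vec p (cleared p c r)) / real c)"

lemma digit_sum_upto:
  assumes "p > 1" "t < p ^ M"
  shows "digit_sum p t = (\<Sum>j<M. t div p ^ j mod p)"
proof -
  have "t div p ^ j = 0" if "j \<ge> M" for j
    using assms that by (meson div_less less_le_trans power_increasing less_imp_le)
  then have "{j. t div p ^ j mod p \<noteq> 0} \<subseteq> {..<M}"
    by (metis (mono_tags, lifting) CollectD lessThan_iff mod_0 not_less subsetI)
  then show ?thesis unfolding digit_sum_def
    by (intro sum.mono_neutral_left) auto
qed

lemma digit_sum_concat:
  assumes p: "p > 1" and t: "t < p ^ c"
  shows "digit_sum p (t + p ^ c * s) = digit_sum p t + digit_sum p s"
proof -
  obtain M where M: "s < p ^ M"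
    using p by (metis less_exp order_less_le_trans Suc_leI power_mono one_add_one plus_1_eq_Suc zero_le_numeral numeral_2_eq_2 zero_le)
  have "t + p ^ c * s < p ^ c * (s + 1)" using t by simp
  also have "\<dots> \<le> p ^ (c + M)" using M by (simp add: power_add del: mult_Suc_right)
  finally have lt: "t + p ^ c * s < p ^ (c + M)" .
  have lo: "(t + p ^ c * s) div p ^ j mod p = t div p ^ j mod p" if "j < c" for j
  proof -
    have e: "p ^ c = p ^ j * (p * p ^ (c - j - 1))"
      using that by (simp flip: power_add power_Suc)
    have "(t + p ^ c * s) div p ^ j = t div p ^ j + p * (p ^ (c - j - 1) * s)"
      unfolding e using p by (simp add: mult.assoc)
    then show ?thesis by simp
  qed
  have hi: "(t + p ^ c * s) div p ^ (c + j) mod p = s div p ^ j mod p" for j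
    using t p by (simp add: power_add div_mult2_eq)
  have "digit_sum p (t + p ^ c * s) = (\<Sum>j<c+M. (t + p ^ c * s) div p ^ j mod p)"
    using digit_sum_upto[OF p lt] .
  also have "\<dots> = (\<Sum>j<c. (t + p ^ c * s) div p ^ j mod p)
      + (\<Sum>j<M. (t + p ^ c * s) div p ^ (c + j) mod p)"
    by (induction M) auto
  also have "\<dots> = digit_sum p t + digit_sum p s"
    using lo hi digit_sum_upto[OF p t] digit_sum_upto[OF p M] by simp
  finally show ?thesis .
qed

lemma digit_sum_repeat:
  assumes "p > 1" "t < p ^ c"
  shows "digit_sum p (t * (\<Sum>i<k. p ^ (c * i))) = k * digit_sum p t"
proof (induction k)
  case 0
  show ?case by (simp add: digit_sum_def)
next
  case (Suc k)
  have "t * (\<Sum>i<Suc k. p ^ (c * i)) = t + p ^ c * (t * (\<Sum>i<k. p ^ (c * i)))"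
    by (simp add: sum.lessThan_Suc_shift power_add sum_distrib_left algebra_simps del: sum.lessThan_Suc)
  then show ?case using digit_sum_concat[OF assms] Suc by simp
qed

lemma cleared_mult:
  assumes p: "p > 1" and c: "c > 0" "clears p c r" and k: "k > 0"
    and r: "\<And>i. -1 \<le> r $ i \<and> r $ i \<le> 0"
  shows "clears p (c * k) r"
    and "digit_sum_vec p (cleared p (c * k) r) = k * digit_sum_vec p (cleared p c r)"
proof -
  have "\<exists>m. (1 - of_nat p ^ c) * r $ i = of_nat m" for i
    using c(2) unfolding clears_def by (blast elim: Nats_cases)
  then obtain t where t: "\<And>i. (1 - of_nat p ^ c) * r $ i = of_nat (t i)" by metis
  have geo: "(1 - (of_nat p :: rat) ^ (c * k)) = (1 - of_nat p ^ c) * (\<Sum>i<k. of_nat p ^ (c * i))"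
    by (simp add: power_mult one_diff_power_eq)
  have tk: "(1 - of_nat p ^ (c * k)) * r $ i = of_nat (t i * (\<Sum>i<k. p ^ (c * i)))" for i
    unfolding geo of_nat_mult t[symmetric] by (simp add: algebra_simps)
  have tlt: "t i < p ^ c" for i
  proof -
    have pc: "(of_nat p :: rat) ^ c \<ge> 1" using p by simp
    have "of_nat (t i) = (of_nat p ^ c - 1) * (- r $ i)" using t[of i] by (simp add: algebra_simps)
    also have "\<dots> \<le> (of_nat p ^ c - 1) * 1"
      using pc r[of i] by (intro mult_left_mono) (auto simp: algebra_simps)
    finally have "rat_of_nat (t i) \<le> rat_of_nat p ^ c - 1" by (simp only: mult_1_right)
    then have "rat_of_nat (t i) < rat_of_nat p ^ c" by (rule le_less_trans) simp
    then have "rat_of_nat (t i) < of_nat (p ^ c)" by (simp only: of_nat_power)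
    then show ?thesis unfolding of_nat_less_iff .
  qed
  show "clears p (c * k) r" unfolding clears_def tk by (simp only: of_nat_in_Nats simp_thms)
  show "digit_sum_vec p (cleared p (c * k) r) = k * digit_sum_vec p (cleared p c r)"
    unfolding digit_sum_vec_def cleared_def using digit_sum_repeat[OF p tlt]
    by (simp only: tk t floor_of_nat nat_int vec_lambda_beta sum_distrib_left)
qed

lemma weight_eq:
  assumes p: "p > 1" and r: "r \<in> R_set p" and c: "c > 0" "clears p c r"
  shows "weight p r = real (digit_sum_vec p (cleared p c r)) / real c"
proof -
  define d where "d = (SOME c. 0 < c \<and> clears p c r)"
  have d: "0 < d" "clears p d r"
    unfolding d_def using someI_ex[of "\<lambda>c. 0 < c \<and> clears p c r"] c by auto
  have b: "\<And>i. -1 \<le> r $ i \<and> r $ i \<le> 0" using r by (simp add: R_set_def)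
  have "d * digit_sum_vec p (cleared p c r) = c * digit_sum_vec p (cleared p d r)"
    using cleared_mult(2)[OF p c d(1) b] cleared_mult(2)[OF p d c(1) b] by (simp add: mult.commute)
  then have "real d * real (digit_sum_vec p (cleared p c r)) = real c * real (digit_sum_vec p (cleared p d r))"
    by (metis of_nat_mult)
  then show ?thesis
    using c d(1) by (simp add: weight_def Let_def d_def[symmetric] field_simps)
qed

section \<open>Fibres of the map from \<open>R\<close> to \<open>RA\<close>\<close>

definition real_vec :: "int ^ 'n \<Rightarrow> real ^ 'n" where
  "real_vec x = (\<chi> j. of_int (x $ j))"

definition lin_comb :: "('m::finite \<Rightarrow> int ^ 'n) \<Rightarrow> rat ^ 'm \<Rightarrow> real ^ 'n" where
  "lin_comb A r = (\<Sum>i\<in>UNIV. of_rat (r $ i) *\<^sub>R real_vec (A i))"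

definition RA :: "nat \<Rightarrow> ('m::finite \<Rightarrow> int ^ 'n) \<Rightarrow> (real ^ 'n) set" where
  "RA p A = lin_comb A ` R_set p"

definition R_fibre :: "nat \<Rightarrow> ('m::finite \<Rightarrow> int ^ 'n) \<Rightarrow> real ^ 'n \<Rightarrow> (rat ^ 'm) set" where
  "R_fibre p A \<gamma> = {r \<in> R_set p. lin_comb A r = \<gamma>}"

definition w_fibre :: "nat \<Rightarrow> ('m::finite \<Rightarrow> int ^ 'n) \<Rightarrow> real ^ 'n \<Rightarrow> ereal" where
  "w_fibre p A \<gamma> = (INF r\<in>R_fibre p A \<gamma>. ereal (weight p r))"

definition R_fibre_at ::
    "nat \<Rightarrow> ('m::finite \<Rightarrow> int ^ 'n) \<Rightarrow> real ^ 'n \<Rightarrow> nat \<Rightarrow> (rat ^ 'm) set" where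
  "R_fibre_at p A \<gamma> c = {r \<in> R_fibre p A \<gamma>. clears p c r}"

definition w_fibre_at ::
    "nat \<Rightarrow> ('m::finite \<Rightarrow> int ^ 'n) \<Rightarrow> real ^ 'n \<Rightarrow> nat \<Rightarrow> ereal" where
  "w_fibre_at p A \<gamma> c =
     (if R_fibre_at p A \<gamma> c = {} then \<infinity>
      else Min ((\<lambda>r. ereal (weight p r)) ` R_fibre_at p A \<gamma> c))"

lemma finite_R_fibre_at:
  fixes A :: "'m::finite \<Rightarrow> int ^ 'n"
  assumes p: "p > 1" and c: "c > 0"
  shows "finite (R_fibre_at p A \<gamma> c)"
proof -
  have ne: "1 - (of_nat p :: rat) ^ c \<noteq> 0" using p c
    by (metis diff_eq_diff_eq diff_self eq_iff_diff_eq_0 of_nat_1 of_nat_eq_iff of_nat_power one_less_power less_irrefl)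
  define S where "S = (\<lambda>t. rat_of_nat t / (1 - of_nat p ^ c)) ` {..<p ^ c}"
  have "R_fibre_at p A \<gamma> c \<subseteq> vec_lambda ` {f. \<forall>i. f i \<in> S}"
  proof
    fix r assume "r \<in> R_fibre_at p A \<gamma> c"
    then have r: "clears p c r" "r \<in> R_set p" by (auto simp: R_fibre_at_def R_fibre_def)
    have "r $ i \<in> S" for i
    proof -
      obtain t where t: "(1 - of_nat p ^ c) * r $ i = of_nat t"
        using r(1) unfolding clears_def by (blast elim: Nats_cases)
      have b: "-1 \<le> r $ i" using r(2) by (simp add: R_set_def)
      have pc: "(of_nat p :: rat) ^ c \<ge> 1" using p by simp
      have "of_nat t = (of_nat p ^ c - 1) * (- r $ i)" using t by (simp add: algebra_simps)
      also have "\<dots> \<le> (of_nat p ^ c - 1) * 1"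
        using pc b by (intro mult_left_mono) (auto simp: algebra_simps)
      finally have "rat_of_nat t \<le> rat_of_nat p ^ c - 1" by (simp only: mult_1_right)
      then have "rat_of_nat t < rat_of_nat p ^ c" by (rule le_less_trans) simp
      then have "rat_of_nat t < of_nat (p ^ c)" by (simp only: of_nat_power)
      then have "t < p ^ c" unfolding of_nat_less_iff .
      moreover have "r $ i = of_nat t / (1 - of_nat p ^ c)" using t ne by (simp add: field_simps)
      ultimately show ?thesis unfolding S_def by auto
    qed
    then show "r \<in> vec_lambda ` {f. \<forall>i. f i \<in> S}" by (auto intro!: image_eqI[of _ _ "vec_nth r"])
  qed
  moreover have "finite {f :: 'm \<Rightarrow> rat. \<forall>i. f i \<in> S}"
    using finite_set_of_finite_funs[of "UNIV :: 'm set" S] by (simp add: S_def)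
  ultimately show ?thesis by (rule finite_subset[OF _ finite_imageI])
qed

section \<open>The cone and its faces\<close>

definition Delta :: "('m::finite \<Rightarrow> int ^ 'n) \<Rightarrow> (real ^ 'n) set" where
  "Delta A = convex hull (range (\<lambda>i. real_vec (A i)) \<union> {0})"

definition Cone :: "('m::finite \<Rightarrow> int ^ 'n) \<Rightarrow> (real ^ 'n) set" where
  "Cone A = cone hull (Delta A)"

definition smallest_face :: "(real ^ 'n) set \<Rightarrow> real ^ 'n \<Rightarrow> (real ^ 'n) set" where
  "smallest_face C x = \<Inter>{F. F face_of C \<and> closed F \<and> x \<in> F}"

definition open_face :: "(real ^ 'n) set \<Rightarrow> (real ^ 'n) set" where
  "open_face F = F - \<Union>{G. G face_of F \<and> closed G \<and> G \<noteq> F}"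

definition Gamma_set :: "nat \<Rightarrow> ('m::finite \<Rightarrow> int ^ 'n) \<Rightarrow> real ^ 'n \<Rightarrow> (real ^ 'n) set" where
  "Gamma_set p A \<beta> =
     uminus ` open_face (smallest_face (Cone A) (-\<beta>)) \<inter> {\<beta> + real_vec z | z. True} \<inter> RA p A"

lemma finite_Gamma_set:
  fixes A :: "'m::finite \<Rightarrow> int ^ 'n"
  shows "finite (Gamma_set p A \<beta>)"
proof -
  define K where "K = (\<Sum>i\<in>UNIV. norm (real_vec (A i)))"
  have K: "norm x \<le> K" if x: "x \<in> RA p A" for x
  proof -
    obtain r where r: "r \<in> R_set p" "x = lin_comb A r" using x by (auto simp: RA_def)
    have "norm x \<le> (\<Sum>i\<in>UNIV. norm ((of_rat (r $ i) :: real) *\<^sub>R real_vec (A i)))"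
      unfolding r lin_comb_def by (rule norm_sum)
    also have "\<dots> \<le> K" unfolding K_def
    proof (intro sum_mono)
      fix i
      have "\<bar>r $ i\<bar> \<le> 1" using r(1) by (auto simp: R_set_def abs_le_iff)
      then have "\<bar>real_of_rat (r $ i)\<bar> \<le> 1" by (metis abs_of_rat of_rat_1 of_rat_less_eq)
      then show "norm ((of_rat (r $ i) :: real) *\<^sub>R real_vec (A i)) \<le> norm (real_vec (A i))"
        by (simp add: mult_left_le_one_le)
    qed
    finally show ?thesis .
  qed
  define S where "S = {m::int. \<bar>real_of_int m\<bar> \<le> K + norm \<beta>}"
  have "S \<subseteq> {- \<lceil>K + norm \<beta>\<rceil> .. \<lceil>K + norm \<beta>\<rceil>}" unfolding S_def by (auto simp: abs_le_iff) linarith+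
  then have S: "finite S" using finite_subset by blast
  have "Gamma_set p A \<beta> \<subseteq> (\<lambda>f. \<beta> + real_vec (vec_lambda f)) ` {f. \<forall>i. f i \<in> S}"
  proof
    fix x assume "x \<in> Gamma_set p A \<beta>"
    then obtain z where z: "x = \<beta> + real_vec z" "x \<in> RA p A" by (auto simp: Gamma_set_def)
    have "z $ i \<in> S" for i
    proof -
      have "\<bar>real_of_int (z $ i)\<bar> = \<bar>(x - \<beta>) $ i\<bar>" by (simp add: z(1) real_vec_def)
      also have "\<dots> \<le> norm (x - \<beta>)" by (rule component_le_norm_cart)
      also have "\<dots> \<le> K + norm \<beta>" using K[OF z(2)] norm_triangle_ineq4[of x \<beta>] by linarith
      finally show ?thesis by (simp add: S_def)
    qed
    then show "x \<in> (\<lambda>f. \<beta> + real_vec (vec_lambda f)) ` {f. \<forall>i. f i \<in> S}"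
      using z(1) by (auto intro!: image_eqI[of _ _ "vec_nth z"])
  qed
  moreover have "finite {f :: 'n \<Rightarrow> int. \<forall>i. f i \<in> S}"
    using finite_set_of_finite_funs[of "UNIV :: 'n set" S] S by simp
  ultimately show ?thesis by (rule finite_subset[OF _ finite_imageI])
qed

section \<open>An algebraic closure of the \<open>p\<close>-adic numbers\<close>

text \<open>An additive valuation with value \<open>1\<close> at \<open>p\<close>; on the rationals it is necessarily the
  \<open>p\<close>-adic valuation.\<close>
definition extends_padic_val :: "nat \<Rightarrow> ('k::field_char_0 \<Rightarrow> ereal) \<Rightarrow> bool" where
  "extends_padic_val p val \<longleftrightarrow>
     (\<forall>x. val x \<noteq> -\<infinity>) \<and>
     (\<forall>x. val x = \<infinity> \<longleftrightarrow> x = 0) \<and>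
     (\<forall>x y. val (x * y) = val x + val y) \<and>
     (\<forall>x y. val (x + y) \<ge> min (val x) (val y)) \<and>
     val (of_nat p) = 1"

definition val_lim :: "('k::field_char_0 \<Rightarrow> ereal) \<Rightarrow> (nat \<Rightarrow> rat) \<Rightarrow> 'k \<Rightarrow> bool" where
  "val_lim val s x \<longleftrightarrow> (\<lambda>k. val (of_rat (s k) - x)) \<longlonglongrightarrow> \<infinity>"

definition val_Cauchy :: "('k::field_char_0 \<Rightarrow> ereal) \<Rightarrow> (nat \<Rightarrow> rat) \<Rightarrow> bool" where
  "val_Cauchy val s \<longleftrightarrow>
     (\<forall>M::real. \<exists>k0. \<forall>i\<ge>k0. \<forall>j\<ge>k0. val (of_rat (s i) - of_rat (s j)) \<ge> ereal M)"

text \<open>The closure of the rationals; it is a copy of the \<open>p\<close>-adic numbers once every Cauchy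
  sequence of rationals converges.\<close>
definition rat_closure :: "('k::field_char_0 \<Rightarrow> ereal) \<Rightarrow> 'k set" where
  "rat_closure val = {x. \<exists>s. val_lim val s x}"

text \<open>The field \<open>'k\<close> is an algebraic closure of the \<open>p\<close>-adic numbers and \<open>val\<close> is its \<open>p\<close>-adic
  valuation (this determines the pair up to isomorphism).\<close>
definition padic_alg_closure ::
    "nat \<Rightarrow> ('k::{alg_closed_field, field_char_0} \<Rightarrow> ereal) \<Rightarrow> bool" where
  "padic_alg_closure p val \<longleftrightarrow>
     extends_padic_val p val \<and>
     (\<forall>s. val_Cauchy val s \<longrightarrow> (\<exists>x. val_lim val s x)) \<and>
     (\<forall>x. \<exists>q. q \<noteq> 0 \<and> (\<forall>i. poly.coeff q i \<in> rat_closure val) \<and> poly q x = 0)"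

section \<open>The hypergeometric series\<close>

definition L_set :: "('m::finite \<Rightarrow> int ^ 'n) \<Rightarrow> (int ^ 'm) set" where
  "L_set A = {l. (\<Sum>i\<in>UNIV. l $ i *s A i) = 0}"

definition rat_vec :: "int ^ 'm \<Rightarrow> rat ^ 'm" where
  "rat_vec l = (\<chi> i. of_int (l $ i))"

definition nsupp :: "rat ^ 'm \<Rightarrow> 'm set" where
  "nsupp v = {i. v $ i \<in> \<int> \<and> v $ i < 0}"

definition L_at :: "('m::finite \<Rightarrow> int ^ 'n) \<Rightarrow> rat ^ 'm \<Rightarrow> (int ^ 'm) set" where
  "L_at A v = {l \<in> L_set A. nsupp (v + rat_vec l) = nsupp v}"

definition minus_bracket :: "rat ^ 'm \<Rightarrow> int ^ 'm \<Rightarrow> rat" where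
  "minus_bracket v l = (\<Prod>i | l $ i < 0. \<Prod>j = 1..nat (- (l $ i)). v $ i - of_nat j + 1)"

text \<open>This is \<open>[v + l]\<close> with index \<open>l\<^sub>+\<close>, as a function of \<open>v\<close> and \<open>l\<close>.\<close>
definition plus_bracket :: "rat ^ 'm \<Rightarrow> int ^ 'm \<Rightarrow> rat" where
  "plus_bracket v l = (\<Prod>i | l $ i > 0. \<Prod>j = 1..nat (l $ i). v $ i + of_nat j)"

text \<open>A formal series in monomials with rational exponent vectors is represented by its coefficient
  function: \<open>Phi \<pi> A v u\<close> is the coefficient of the monomial \<open>\<lambda>\<^sup>u\<close>. The sum has at most one
  term, as \<open>u\<close> and \<open>v\<close> determine \<open>l\<close>.\<close>
definition Phi ::
    "'k::field_char_0 \<Rightarrow> ('m::finite \<Rightarrow> int ^ 'n) \<Rightarrow> rat ^ 'm \<Rightarrow> (rat ^ 'm \<Rightarrow> 'k)" where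
  "Phi \<pi> A v = (\<lambda>u. \<Sum>l | l \<in> L_at A v \<and> u = v + rat_vec l.
     of_rat (minus_bracket v l / plus_bracket v l) * \<pi> powi (\<Sum>i\<in>UNIV. l $ i))"

end

theory Submission
  imports Defs "HOL-Number_Theory.Residues"
begin

text \<open>A vector \<open>r\<close> in \<open>R\<^sub>\<gamma>\<close> with \<open>(1 - p\<^bsup>am\<^esup>) r = V\<close> is read as a closed walk of length \<open>m\<close> in \<open>\<Gamma>\<close>:
  rotating the base \<open>p\<^sup>a\<close> digits \<open>s\<close> of \<open>V\<close> by one place turns \<open>\<gamma>\<close> into the point \<open>\<gamma>'\<close> with
  \<open>p\<^sup>a \<gamma>' = \<gamma> - \<Sum> s\<^sub>i a\<^sub>i\<close>, which lies in \<open>\<Gamma>\<close> again, and \<open>a w(r)\<close> is the mean digit sum along the walk.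
  Conversely every closed walk comes from such an \<open>r\<close>. Cutting a walk at a repeated vertex yields
  two closed walks one of which has no larger mean, so the minimum is attained on a walk of length
  at most \<open>B\<close>.

  For integrality, the \<open>p\<close>-adic integers \<open>v\<^sub>i\<close> in a coefficient are replaced by natural numbers
  \<open>V\<^sub>i = (1 - p\<^sup>K) v\<^sub>i\<close> with \<open>0 \<le> V\<^sub>i + l\<^sub>i < p\<^sup>K\<close>. Legendre's formula then gives \<open>p - 1\<close> times the valuation
  as \<open>w\<^sub>p(V + l) - w\<^sub>p(V)\<close>, and \<open>(V + l) / (1 - p\<^sup>K)\<close> is another element of \<open>R\<^sub>\<gamma>\<close>, so minimality of \<open>w(v)\<close>
  makes this nonnegative.\<close>

section \<open>Legendre's formula\<close>

lemma digit_sum_less: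
  assumes "p > 1" "t < p"
  shows "digit_sum p t = t"
  using digit_sum_upto[of p t 1] assms by simp

lemma digit_sum_rec:
  assumes "p > 1"
  shows "digit_sum p n = n mod p + digit_sum p (n div p)"
  using digit_sum_concat[of p "n mod p" 1 "n div p"] assms digit_sum_less[of p "n mod p"] by simp

text \<open>Adding one turns the trailing digits \<open>p - 1\<close> of \<open>n\<close> into
  zeros, as many as the multiplicity of \<open>p\<close> in \<open>Suc n\<close>, and raises the
  next digit by one. The induction strips one trailing digit at a time.\<close>

lemma digit_sum_Suc:
  assumes p: "prime p"
  shows "digit_sum p (Suc n) + (p - 1) * multiplicity p (Suc n) = digit_sum p n + 1"
proof (induction n rule: less_induct)
  case (less n)
  have p1: "p > 1" using prime_gt_1_nat[OF p] .
  show ?case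
  proof (cases "p dvd Suc n")
    case False
    then have "Suc n div p = n div p" "Suc n mod p = Suc (n mod p)"
      by (auto simp: div_Suc mod_Suc dvd_eq_mod_eq_0)
    then show ?thesis
      using digit_sum_rec[OF p1, of n] digit_sum_rec[OF p1, of "Suc n"] False
      by (simp add: not_dvd_imp_multiplicity_0)
  next
    case True
    then obtain k where "Suc n = p * k" by (elim dvdE)
    then obtain k where k: "Suc n = p * Suc k" by (cases k) auto
    \<comment> \<open>The last digit of \<open>n\<close> is \<open>p - 1\<close> and the others form
      \<open>k\<close>; the exponent \<open>1\<close> matches the shape of
      \<open>digit_sum_concat\<close>.\<close>
    have n: "n = (p - 1) + p ^ 1 * k" using k p1 by simp
    have "k < n"
    proof -
      have "2 * k \<le> p * k" using p1 by (intro mult_right_mono) auto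
      moreover have "n + 1 = p + p * k" using n p1 by simp
      ultimately show ?thesis using p1 by linarith
    qed
    from less[OF this]
    have IH: "digit_sum p (Suc k) + (p - 1) * multiplicity p (Suc k) = digit_sum p k + 1" .
    have 1: "digit_sum p (Suc n) = digit_sum p (Suc k)"
      unfolding k using digit_sum_rec[OF p1, of "p * Suc k"] p1 by (simp del: mult_Suc_right)
    have 2: "digit_sum p n = (p - 1) + digit_sum p k"
      by (subst n, subst digit_sum_concat) (use p1 in \<open>auto simp: digit_sum_less\<close>)
    have 3: "multiplicity p (Suc n) = Suc (multiplicity p (Suc k))"
      unfolding k using p by (intro multiplicity_times_same) auto
    show ?thesis using IH p1 unfolding 1 2 3 mult_Suc_right by linarith
  qed
qed

text \<open>Telescoping \<open>digit_sum_Suc\<close> gives Legendre's formula for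
  \<open>(V + n)! / V!\<close>. Real numbers make room for the subtraction.\<close>

lemma legendre_up:
  assumes p: "prime p"
  shows "real (p - 1) * (\<Sum>j = 1..n. real (multiplicity p (V + j)))
    = real n + real (digit_sum p V) - real (digit_sum p (V + n))"
proof (induction n)
  case 0
  then show ?case by simp
next
  case (Suc n)
  have "real (digit_sum p (Suc (V + n)) + (p - 1) * multiplicity p (Suc (V + n)))
      = real (digit_sum p (V + n) + 1)"
    using digit_sum_Suc[OF p] by presburger
  with Suc show ?case by (simp add: distrib_left)
qed

text \<open>These are the factors of \<open>V! / (V - n)!\<close> listed from the top; reversing
  their order reduces to \<open>legendre_up\<close> started at \<open>V - n\<close>.\<close>

lemma legendre_down:
  assumes p: "prime p" and n: "n \<le> V"
  shows "real (p - 1) * (\<Sum>j = 1..n. real (multiplicity p (V + 1 - j)))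
    = real n + real (digit_sum p (V - n)) - real (digit_sum p V)"
proof -
  have "(\<Sum>j = 1..n. real (multiplicity p (V + 1 - j))) = (\<Sum>j = 1..n. real (multiplicity p (V - n + j)))"
    using n by (intro sum.reindex_bij_witness[of _ "\<lambda>j. n + 1 - j" "\<lambda>j. n + 1 - j"]) auto
  then show ?thesis using legendre_up[OF p, of "V - n" n] n by simp
qed

section \<open>Valuations of the coefficients\<close>

context
  fixes p :: nat and val :: "'k::field_char_0 \<Rightarrow> ereal"
  assumes p: "prime p" and val: "extends_padic_val p val"
begin

text \<open>A real-valued copy of the valuation that admits subtraction and scaling. At
  \<open>0\<close> the infinite value becomes the default \<open>0\<close>, hence the nonzero
  conditions below.\<close>

definition rval :: "'k \<Rightarrow> real" where
  "rval x = real_of_ereal (val x)"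

lemma val_eq_rval: "x \<noteq> 0 \<Longrightarrow> val x = ereal (rval x)"
  using val unfolding rval_def extends_padic_val_def by (cases "val x") auto

lemma val_zero: "val 0 = \<infinity>"
  using val by (simp add: extends_padic_val_def)

lemma rval_mult:
  assumes "x \<noteq> 0" "y \<noteq> 0"
  shows "rval (x * y) = rval x + rval y"
proof -
  have "val (x * y) = val x + val y" using val by (simp add: extends_padic_val_def)
  then show ?thesis using assms by (simp add: val_eq_rval)
qed

lemma rval_one: "rval 1 = 0"
  using rval_mult[of 1 1] by simp

lemma rval_minus: "rval (- x) = rval x"
proof (cases "x = 0")
  case False
  have "rval (-1) = 0" using rval_mult[of "-1" "-1"] rval_one by simp
  then show ?thesis using rval_mult[of "-1" x] False by simp
qed simp

lemma rval_divide:
  assumes "x \<noteq> 0" "y \<noteq> 0"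
  shows "rval (x / y) = rval x - rval y"
proof -
  have "rval (x / y * y) = rval (x / y) + rval y" using assms by (intro rval_mult) auto
  then show ?thesis using assms by simp
qed

lemma rval_power: "x \<noteq> 0 \<Longrightarrow> rval (x ^ n) = real n * rval x"
proof (induction n)
  case (Suc n)
  then show ?case by (simp add: rval_mult distrib_right)
qed (simp add: rval_one)

lemma rval_powi:
  assumes "x \<noteq> 0"
  shows "rval (x powi n) = real_of_int n * rval x"
proof (cases "n \<ge> 0")
  case True
  then show ?thesis using assms by (simp add: power_int_def rval_power)
next
  case False
  then show ?thesis using assms rval_divide[of 1 "x ^ nat (- n)"]
    by (simp add: power_int_def rval_power rval_one divide_inverse power_inverse)
qed

lemma rval_prod:
  assumes "finite I" "\<And>i. i \<in> I \<Longrightarrow> f i \<noteq> 0"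
  shows "rval (\<Prod>i\<in>I. f i) = (\<Sum>i\<in>I. rval (f i))"
  using assms by (induction I rule: finite_induct) (simp_all add: rval_one rval_mult)

lemma rval_add_ge:
  assumes "x \<noteq> 0" "y \<noteq> 0" "x + y \<noteq> 0"
  shows "rval (x + y) \<ge> min (rval x) (rval y)"
proof -
  have "val (x + y) \<ge> min (val x) (val y)" using val by (simp add: extends_padic_val_def)
  then show ?thesis using assms by (simp add: val_eq_rval min_def split: if_splits)
qed

text \<open>Writing \<open>x\<close> as \<open>(x + y) + (- y)\<close> bounds
  \<open>rval (x + y)\<close> from above, because the minimum cannot be attained at
  \<open>- y\<close>.\<close>

lemma rval_add_eq:
  assumes "x \<noteq> 0" "y \<noteq> 0" "rval x < rval y"
  shows "rval (x + y) = rval x"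
proof -
  have nz: "x + y \<noteq> 0"
    using assms rval_minus[of y] by (metis add_eq_0_iff2 less_irrefl)
  have "rval (x + y) \<ge> rval x" using rval_add_ge[OF assms(1,2) nz] assms(3) by simp
  moreover have "rval x \<ge> min (rval (x + y)) (rval (- y))"
    using rval_add_ge[of "x + y" "- y"] nz assms by simp
  ultimately show ?thesis using assms(3) rval_minus[of y] by (simp add: min_def split: if_splits)
qed

section \<open>Valuations of integers\<close>

lemma rval_of_nat_nonneg: "n > 0 \<Longrightarrow> rval (of_nat n) \<ge> 0"
proof (induction n)
  case (Suc n)
  show ?case
  proof (cases "n = 0")
    case False
    then have "rval (1 + of_nat n) \<ge> min (rval 1) (rval (of_nat n))"
      by (intro rval_add_ge) (simp_all flip: of_nat_Suc)
    then show ?thesis using Suc False rval_one by simp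
  qed (simp add: rval_one)
qed simp

lemma rval_of_int_nonneg: "n \<noteq> 0 \<Longrightarrow> rval (of_int n) \<ge> 0"
  using rval_of_nat_nonneg[of "nat \<bar>n\<bar>"] rval_minus[of "of_int n"]
  by (cases "n > 0") auto

lemma rval_of_nat_prime: "rval (of_nat p) = 1"
  using val by (simp add: rval_def extends_padic_val_def)

text \<open>If \<open>n\<close> had positive valuation, a Bezout identity
  \<open>u * p + v * n = 1\<close> would give \<open>1\<close> a positive valuation.\<close>

lemma rval_of_int_unit:
  assumes "\<not> int p dvd n"
  shows "rval (of_int n) = 0"
proof (rule ccontr)
  have n0: "n \<noteq> 0" using assms by auto
  have p0: "p > 0" using prime_gt_0_nat[OF p] .
  assume "rval (of_int n) \<noteq> 0"
  then have pos: "rval (of_int n) > 0" using rval_of_int_nonneg[OF n0] by simp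
  have "coprime (int p) n" using p assms by (simp add: prime_imp_coprime)
  then obtain u v where uv: "u * int p + v * n = 1" by (metis bezout_int coprime_imp_gcd_eq_1)
  then have eq: "(1::'k) = of_int u * of_nat p + of_int v * of_int n"
    by (metis of_int_1 of_int_add of_int_mult of_int_of_nat_eq)
  have 1: "rval (of_int u * of_nat p) > 0" if "u \<noteq> 0"
    using that rval_of_int_nonneg[OF that] p0 by (simp add: rval_mult rval_of_nat_prime)
  have 2: "rval (of_int v * of_int n) > 0" if "v \<noteq> 0"
    using that rval_of_int_nonneg[OF that] pos n0 by (simp add: rval_mult)
  have "rval 1 > 0"
  \<comment> \<open>A vanishing coefficient is treated separately, since \<open>rval\<close> is
    \<open>0\<close> rather than infinite there.\<close>
  proof (cases "u = 0 \<or> v = 0")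
    case True
    then have "u = 0 \<and> v \<noteq> 0 \<or> u \<noteq> 0 \<and> v = 0" using uv by auto
    then show ?thesis using 1 2 eq by auto
  next
    case False
    then have "of_int u * of_nat p \<noteq> (0::'k)" "of_int v * of_int n \<noteq> (0::'k)" using p0 n0 by auto
    from rval_add_ge[OF this] show ?thesis using 1 2 False eq by auto
  qed
  then show False by (simp add: rval_one)
qed

text \<open>Among nonzero elements the definition prescribes only the value at \<open>p\<close>;
  splitting off the power of \<open>p\<close> leaves a factor prime to \<open>p\<close>, of
  valuation zero.\<close>

lemma rval_of_nat:
  assumes "n > 0"
  shows "rval (of_nat n) = real (multiplicity p n)"
proof -
  have "n \<noteq> 0" "\<not> is_unit p" using assms p by auto
  from multiplicity_decompose'[OF this] obtain y where y: "n = p ^ multiplicity p n * y" "\<not> p dvd y"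
    by metis
  have p0: "p > 0" using prime_gt_0_nat[OF p] .
  have y0: "y \<noteq> 0" using y assms by (metis dvd_0_right)
  have "rval (of_nat y) = 0" using rval_of_int_unit[of "int y"] y by simp
  moreover have "rval (of_nat n) = rval (of_nat p ^ multiplicity p n * of_nat y)"
    by (subst y(1)) simp
  ultimately show ?thesis
    using p0 y0 by (simp add: rval_mult rval_power rval_of_nat_prime)
qed

text \<open>The truncation \<open>V\<close> of the \<open>p\<close>-adic integer \<open>V / (1 - p\<^sup>K) = V + V p\<^sup>K + \<dots>\<close> may replace
  it in the factors of the brackets.\<close>

lemma rval_shifted:
  assumes K: "K > 0" and h: "0 < int V + h" "int V + h < int p ^ K"
    and r: "(1 - of_nat p ^ K) * r = rat_of_nat V"
  shows "r + of_int h \<noteq> 0"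
    and "rval (of_rat (r + of_int h)) = real (multiplicity p (nat (int V + h)))"
proof -
  define M where "M = nat (int V + h)"
  have M: "M > 0" "M < p ^ K" "of_nat M = int V + h"
    using h unfolding M_def by (auto simp: nat_less_iff)
  have p1: "p > 1" using prime_gt_1_nat[OF p] .
  define u :: int where "u = 1 - int p ^ K"
  have pu: "\<not> int p dvd u"
  proof
    assume "int p dvd u"
    then have "int p dvd u + int p ^ K" using K by (intro dvd_add) auto
    then show False using p1 by (simp add: u_def)
  qed
  have u0: "u \<noteq> 0" using pu by auto
  \<comment> \<open>Multiplying by the \<open>p\<close>-adic unit \<open>1 - p ^ K\<close> turns
    \<open>r + h\<close> into the integer \<open>M - h * p ^ K\<close>.\<close>
  have eq: "of_int u * (r + of_int h) = of_nat M - of_int h * of_nat p ^ K"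
  proof -
    have "of_int u * (r + of_int h) = of_nat V + of_int h - of_int h * (of_nat p ^ K :: rat)"
      using r by (simp add: u_def algebra_simps)
    also have "of_nat V + of_int h = rat_of_nat M"
      by (metis M(3) of_int_add of_int_of_nat_eq)
    finally show ?thesis .
  qed
  \<comment> \<open>As \<open>0 < M < p ^ K\<close>, the valuation of \<open>M\<close> is below that
    of \<open>h * p ^ K\<close> when \<open>h\<close> is nonzero, so \<open>M\<close> decides the
    valuation of the difference.\<close>
  have mult: "multiplicity p M < K"
  proof (rule ccontr)
    assume "\<not> multiplicity p M < K"
    then have "p ^ K dvd M" by (simp add: multiplicity_dvd')
    then show False using M by (auto dest: dvd_imp_le)
  qed
  have key: "of_nat M - of_int h * of_nat p ^ K \<noteq> (0::'k)
    \<and> rval (of_nat M - of_int h * of_nat p ^ K) = real (multiplicity p M)"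
  proof (cases "h = 0")
    case True
    then show ?thesis using M by (simp add: rval_of_nat)
  next
    case False
    have nz: "- (of_int h * of_nat p ^ K) \<noteq> (0::'k)" "of_nat M \<noteq> (0::'k)" using False p1 M by auto
    have "rval (- (of_int h * of_nat p ^ K)) = rval (of_int h) + real K"
      unfolding rval_minus using False p1 by (simp add: rval_mult rval_power rval_of_nat_prime)
    then have lt: "rval (of_nat M) < rval (- (of_int h * of_nat p ^ K))"
      using mult rval_of_int_nonneg[OF False] M by (simp add: rval_of_nat)
    have "of_nat M + - (of_int h * of_nat p ^ K) \<noteq> (0::'k)"
      using lt by (metis add_eq_0_iff2 less_irrefl rval_minus)
    then show ?thesis using rval_add_eq[OF nz(2,1) lt] M by (simp add: rval_of_nat)
  qed
  have "of_rat (of_int u * (r + of_int h)) = (of_nat M - of_int h * of_nat p ^ K :: 'k)"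
    unfolding eq by (simp add: of_rat_diff of_rat_mult of_rat_power)
  then have eq': "of_int u * of_rat (r + of_int h) = (of_nat M - of_int h * of_nat p ^ K :: 'k)"
    by (simp add: of_rat_mult)
  then have nz: "of_rat (r + of_int h) \<noteq> (0::'k)" using key by fastforce
  then show "r + of_int h \<noteq> 0" by auto
  have "rval (of_int u * of_rat (r + of_int h)) = real (multiplicity p M)" using key eq' by simp
  then show "rval (of_rat (r + of_int h)) = real (multiplicity p (nat (int V + h)))"
    using nz u0 rval_of_int_unit[OF pu] by (simp add: rval_mult M_def)
qed

text \<open>The factors are \<open>r + h\<close> with \<open>h = 1 - j\<close>, and
  \<open>n \<le> V\<close> keeps \<open>V + h\<close> positive, as \<open>rval_shifted\<close>
  demands.\<close>

lemma rval_minus_factor: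
  assumes K: "K > 0" and n: "n \<le> V" and V: "V < p ^ K"
    and r: "(1 - of_nat p ^ K) * r = rat_of_nat V"
  shows "(\<Prod>j = 1..n. r - of_nat j + 1) \<noteq> 0"
    and "real (p - 1) * rval (of_rat (\<Prod>j = 1..n. r - of_nat j + 1))
      = real n + real (digit_sum p (V - n)) - real (digit_sum p V)"
proof -
  have *: "r - of_nat j + 1 \<noteq> 0
      \<and> rval (of_rat (r - of_nat j + 1)) = real (multiplicity p (V + 1 - j))"
    if j: "j \<in> {1..n}" for j
  proof -
    have "0 < int V + (1 - int j)" using j n by auto
    moreover have "int V + (1 - int j) < int p ^ K"
    proof -
      have "int V < int p ^ K" "1 \<le> int j" using V j by simp_all
      then show ?thesis by linarith
    qed
    moreover have "nat (int V + (1 - int j)) = V + 1 - j" by auto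
    moreover have "r + of_int (1 - int j) = r - of_nat j + 1" by simp
    ultimately show ?thesis
      using rval_shifted[OF K _ _ r, of "1 - int j"] by metis
  qed
  show "(\<Prod>j = 1..n. r - of_nat j + 1) \<noteq> 0" using * by simp
  have "rval (of_rat (\<Prod>j = 1..n. r - of_nat j + 1)) = (\<Sum>j = 1..n. rval (of_rat (r - of_nat j + 1)))"
    unfolding of_rat_prod using * by (intro rval_prod) (auto simp del: of_rat_diff of_rat_add)
  also have "\<dots> = (\<Sum>j = 1..n. real (multiplicity p (V + 1 - j)))"
    using * by (intro sum.cong) auto
  finally show "real (p - 1) * rval (of_rat (\<Prod>j = 1..n. r - of_nat j + 1))
      = real n + real (digit_sum p (V - n)) - real (digit_sum p V)"
    using legendre_down[OF p n] by simp
qed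

text \<open>Here the shifts are \<open>h = j\<close>, and \<open>V + n < p ^ K\<close> supplies the
  upper bound in \<open>rval_shifted\<close>.\<close>

lemma rval_plus_factor:
  assumes K: "K > 0" and V: "V + n < p ^ K"
    and r: "(1 - of_nat p ^ K) * r = rat_of_nat V"
  shows "(\<Prod>j = 1..n. r + of_nat j) \<noteq> 0"
    and "real (p - 1) * rval (of_rat (\<Prod>j = 1..n. r + of_nat j))
      = real n + real (digit_sum p V) - real (digit_sum p (V + n))"
proof -
  have *: "r + of_nat j \<noteq> 0 \<and> rval (of_rat (r + of_nat j)) = real (multiplicity p (V + j))"
    if j: "j \<in> {1..n}" for j
  proof -
    have "V + j < p ^ K" using j V by auto
    then have "int (V + j) < int (p ^ K)" by (simp only: of_nat_less_iff)
    then have "int V + int j < int p ^ K" "0 < int V + int j" using j by auto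
    from rval_shifted[OF K this(2,1) r] show ?thesis by (simp add: nat_int_add)
  qed
  show "(\<Prod>j = 1..n. r + of_nat j) \<noteq> 0" using * by simp
  have "rval (of_rat (\<Prod>j = 1..n. r + of_nat j)) = (\<Sum>j = 1..n. rval (of_rat (r + of_nat j)))"
    unfolding of_rat_prod using * by (intro rval_prod) (auto simp del: of_rat_add)
  also have "\<dots> = (\<Sum>j = 1..n. real (multiplicity p (V + j)))"
    using * by (intro sum.cong) auto
  finally show "real (p - 1) * rval (of_rat (\<Prod>j = 1..n. r + of_nat j))
      = real n + real (digit_sum p V) - real (digit_sum p (V + n))"
    using legendre_up[OF p] by simp
qed

text \<open>Each index contributes its change of digit sum minus \<open>l $ i\<close>. The power of
  \<open>\<pi>\<close>, where \<open>\<pi>\<close> has valuation \<open>1 / (p - 1)\<close>, cancels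
  the terms \<open>l $ i\<close>.\<close>

lemma bracket_quotient_val:
  fixes v :: "rat ^ 'm::finite"
  assumes K: "K > 0" and v: "\<And>i. (1 - of_nat p ^ K) * v $ i = of_nat (V $ i)"
    and V: "\<And>i. V $ i < p ^ K"
    and W: "\<And>i. int (W $ i) = int (V $ i) + l $ i" "\<And>i. W $ i < p ^ K"
    and pi: "\<pi> ^ (p - 1) = - of_nat p" and le: "digit_sum_vec p V \<le> digit_sum_vec p W"
  shows "0 \<le> val (of_rat (minus_bracket v l / plus_bracket v l) * \<pi> powi (\<Sum>i\<in>UNIV. l $ i))"
proof -
  \<comment> \<open>\<open>d i\<close> is \<open>p - 1\<close> times the valuation that index
    \<open>i\<close> contributes to the quotient of brackets.\<close>
  define d where "d = (\<lambda>i. - real_of_int (l $ i) + real (digit_sum p (W $ i)) - real (digit_sum p (V $ i)))"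
  define F where "F = (\<lambda>i. \<Prod>j = 1..nat (- (l $ i)). v $ i - of_nat j + 1)"
  define G where "G = (\<lambda>i. \<Prod>j = 1..nat (l $ i). v $ i + of_nat j)"
  have p1: "p > 1" using prime_gt_1_nat[OF p] .
  have F: "F i \<noteq> 0 \<and> real (p - 1) * rval (of_rat (F i)) = d i" if "l $ i < 0" for i
  proof -
    have n: "nat (- (l $ i)) \<le> V $ i" "V $ i - nat (- (l $ i)) = W $ i" using W(1)[of i] that by auto
    show ?thesis using rval_minus_factor[OF K n(1) V v] that unfolding F_def d_def n(2) by simp
  qed
  have G: "G i \<noteq> 0 \<and> real (p - 1) * rval (of_rat (G i)) = - d i" if "l $ i > 0" for i
  proof -
    have n: "V $ i + nat (l $ i) = W $ i" using W(1)[of i] that by auto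
    then have "V $ i + nat (l $ i) < p ^ K" using W(2) by metis
    from rval_plus_factor[OF K this v] show ?thesis using that unfolding G_def d_def n by simp
  qed
  have d0: "d i = 0" if "l $ i = 0" for i using W(1)[of i] that by (simp add: d_def)
  have mb: "minus_bracket v l = (\<Prod>i | l $ i < 0. F i)" by (simp add: minus_bracket_def F_def)
  have pb: "plus_bracket v l = (\<Prod>i | l $ i > 0. G i)" by (simp add: plus_bracket_def G_def)
  have nz: "minus_bracket v l \<noteq> 0" "plus_bracket v l \<noteq> 0" unfolding mb pb using F G by auto
  have pi0: "\<pi> \<noteq> 0" using pi p1 by (auto simp: power_0_left split: if_splits)
  have rpi: "real (p - 1) * rval \<pi> = 1"
    unfolding rval_power[OF pi0, symmetric] pi rval_minus rval_of_nat_prime ..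
  have rm: "real (p - 1) * rval (of_rat (minus_bracket v l)) = (\<Sum>i | l $ i < 0. d i)"
  proof -
    have "rval (of_rat (minus_bracket v l)) = (\<Sum>i | l $ i < 0. rval (of_rat (F i)))"
      unfolding mb of_rat_prod using F by (intro rval_prod) auto
    then show ?thesis using F by (simp add: sum_distrib_left)
  qed
  have rp: "real (p - 1) * rval (of_rat (plus_bracket v l)) = - (\<Sum>i | l $ i > 0. d i)"
  proof -
    have "rval (of_rat (plus_bracket v l)) = (\<Sum>i | l $ i > 0. rval (of_rat (G i)))"
      unfolding pb of_rat_prod using G by (intro rval_prod) auto
    then show ?thesis using G by (simp add: sum_distrib_left flip: sum_negf)
  qed
  have split: "(\<Sum>i | l $ i < 0. d i) + (\<Sum>i | l $ i > 0. d i) = (\<Sum>i\<in>UNIV. d i)"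
  proof -
    have "(\<Sum>i | l $ i < 0. d i) + (\<Sum>i | l $ i > 0. d i) = (\<Sum>i\<in>{i. l $ i < 0} \<union> {i. l $ i > 0}. d i)"
      by (rule sum.union_disjoint[symmetric]) auto
    also have "\<dots> = (\<Sum>i\<in>UNIV. d i)" by (rule sum.mono_neutral_left) (auto intro: d0)
    finally show ?thesis .
  qed
  define C where "C = of_rat (minus_bracket v l / plus_bracket v l) * \<pi> powi (\<Sum>i\<in>UNIV. l $ i)"
  have C0: "C \<noteq> 0" using nz pi0 by (simp add: C_def of_rat_divide)
  have "rval C = rval (of_rat (minus_bracket v l)) - rval (of_rat (plus_bracket v l))
      + real_of_int (\<Sum>i\<in>UNIV. l $ i) * rval \<pi>"
    unfolding C_def of_rat_divide using nz pi0 by (simp add: rval_mult rval_divide rval_powi)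
  then have "real (p - 1) * rval C = real (p - 1) * rval (of_rat (minus_bracket v l))
      - real (p - 1) * rval (of_rat (plus_bracket v l))
      + real_of_int (\<Sum>i\<in>UNIV. l $ i) * (real (p - 1) * rval \<pi>)"
    by (simp only: distrib_left right_diff_distrib mult.left_commute)
  also have "\<dots> = (\<Sum>i\<in>UNIV. d i) + real_of_int (\<Sum>i\<in>UNIV. l $ i)"
    unfolding rm rp rpi using split by simp
  also have "\<dots> = real (digit_sum_vec p W) - real (digit_sum_vec p V)"
    unfolding d_def digit_sum_vec_def by (simp add: sum.distrib sum_subtractf sum_negf)
  also have "\<dots> \<ge> 0" using le by simp
  finally have "rval C \<ge> 0" using p1 by (simp add: zero_le_mult_iff)
  then show ?thesis using val_eq_rval[OF C0] by (simp add: C_def)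
qed

end

section \<open>Elements of \<open>R\<close> as fractions\<close>

text \<open>For entries below \<open>p ^ c\<close> these are the \<open>p\<close>-adic integers
  whose digits repeat with period \<open>c\<close>, one period being \<open>V\<close>.\<close>

definition p_frac :: "nat \<Rightarrow> nat \<Rightarrow> nat ^ 'm \<Rightarrow> rat ^ 'm" where
  "p_frac p c V = (\<chi> i. of_nat (V $ i) / (1 - of_nat p ^ c))"

definition int_comb :: "('m::finite \<Rightarrow> int ^ 'n) \<Rightarrow> nat ^ 'm \<Rightarrow> int ^ 'n" where
  "int_comb A V = (\<Sum>i\<in>UNIV. int (V $ i) *s A i)"

lemma one_minus_power_neg:
  assumes "p > 1" "c > 0"
  shows "1 - (of_nat p :: 'a::linordered_field) ^ c < 0"
  using assms by simp

lemma p_frac_mult: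
  assumes "p > 1" "c > 0"
  shows "(1 - of_nat p ^ c) * p_frac p c V $ i = of_nat (V $ i)"
  using one_minus_power_neg[OF assms, where ?'a = rat] by (simp add: p_frac_def)

lemma clears_p_frac:
  assumes "p > 1" "c > 0"
  shows "clears p c (p_frac p c V)"
  unfolding clears_def p_frac_mult[OF assms] by simp

lemma cleared_p_frac:
  assumes "p > 1" "c > 0"
  shows "cleared p c (p_frac p c V) = V"
  unfolding cleared_def p_frac_mult[OF assms] by (simp add: vec_eq_iff)

lemma p_frac_in_R_set:
  assumes p: "p > 1" and c: "c > 0" and V: "\<And>i. V $ i < p ^ c"
  shows "p_frac p c V \<in> R_set p"
proof -
  have neg: "1 - (of_nat p :: rat) ^ c < 0" using one_minus_power_neg[OF p c] .
  have "p_frac p c V $ i \<in> p_integral_rats p" for i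
  proof -
    have "\<not> int p dvd 1 - int p ^ c"
    proof
      assume "int p dvd 1 - int p ^ c"
      then have "int p dvd (1 - int p ^ c) + int p ^ c" using c by (intro dvd_add) auto
      then show False using p by simp
    qed
    moreover have "p_frac p c V $ i = of_int (int (V $ i)) / of_int (1 - int p ^ c)"
      by (simp add: p_frac_def)
    ultimately show ?thesis unfolding p_integral_rats_def by blast
  qed
  moreover have "-1 \<le> p_frac p c V $ i \<and> p_frac p c V $ i \<le> 0" for i
  proof -
    have "rat_of_nat (V $ i + 1) \<le> of_nat (p ^ c)" using V[of i] by (simp only: of_nat_le_iff)
    then have "rat_of_nat (V $ i) \<le> of_nat p ^ c - 1" by simp
    then show ?thesis using neg by (simp add: p_frac_def divide_simps)
  qed
  ultimately show ?thesis by (simp add: R_set_def)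
qed

lemma weight_p_frac:
  assumes "p > 1" "c > 0" "\<And>i. V $ i < p ^ c"
  shows "weight p (p_frac p c V) = real (digit_sum_vec p V) / real c"
  using weight_eq[OF assms(1) p_frac_in_R_set[OF assms] assms(2) clears_p_frac[OF assms(1,2)]]
  unfolding cleared_p_frac[OF assms(1,2)] .

lemma p_frac_exhaust:
  assumes p: "p > 1" and c: "c > 0" "clears p c r" and r: "r \<in> R_set p"
  obtains V where "r = p_frac p c V" "\<And>i. V $ i < p ^ c"
proof -
  have neg: "1 - (of_nat p :: rat) ^ c < 0" using one_minus_power_neg[OF p c(1)] .
  have "\<exists>m. (1 - of_nat p ^ c) * r $ i = of_nat m" for i
    using c(2) unfolding clears_def by (blast elim: Nats_cases)
  then obtain t where t: "\<And>i. (1 - of_nat p ^ c) * r $ i = of_nat (t i)" by metis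
  have "r = p_frac p c (\<chi> i. t i)"
    using neg by (simp add: p_frac_def vec_eq_iff t[symmetric])
  moreover have "t i < p ^ c" for i
  proof -
    have "of_nat (t i) = (of_nat p ^ c - 1) * (- r $ i)" using t[of i] by (simp add: algebra_simps)
    also have "\<dots> \<le> (of_nat p ^ c - 1) * 1"
      using neg r by (intro mult_left_mono) (auto simp: R_set_def minus_le_iff)
    also have "\<dots> < (of_nat (p ^ c) :: rat)" by simp
    finally show ?thesis unfolding of_nat_less_iff .
  qed
  ultimately show thesis using that[of "\<chi> i. t i"] by simp
qed

lemma lin_comb_p_frac:
  "lin_comb A (p_frac p c V) = (1 / (1 - real p ^ c)) *\<^sub>R real_vec (int_comb A V)"
  by (simp add: lin_comb_def p_frac_def int_comb_def real_vec_def vec_eq_iff of_rat_divide of_rat_diff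
      of_rat_power sum_distrib_left)

text \<open>Euler's theorem applies to the product of the denominators, which is prime to
  \<open>p\<close>. The exponent is made a multiple of \<open>a\<close> so that digits can be
  grouped in blocks of length \<open>a\<close>.\<close>

lemma R_set_clears:
  assumes p: "prime p" and r: "r \<in> R_set p" and a: "a > 0"
  obtains m where "m > 0" "clears p (a * m) (r :: rat ^ 'm::finite)"
proof -
  have p1: "p > 1" using prime_gt_1_nat[OF p] .
  have "\<exists>x y. r $ i = of_int x / of_int y \<and> \<not> int p dvd y" for i
    using r by (simp add: R_set_def p_integral_rats_def)
  then obtain x y where xy: "\<And>i. r $ i = of_int (x i) / of_int (y i)" "\<And>i. \<not> int p dvd y i" by metis
  define Y where "Y = nat \<bar>\<Prod>i\<in>UNIV. y i\<bar>"
  have "\<not> int p dvd (\<Prod>i\<in>UNIV. y i)" using xy(2) p by (subst prime_dvd_prod_iff) auto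
  then have pY: "\<not> p dvd Y" unfolding Y_def by (simp add: nat_abs_dvd_iff flip: int_dvd_int_iff)
  then have Y0: "Y > 0" by (cases Y) auto
  define m where "m = totient Y"
  have m0: "m > 0" using Y0 by (simp add: m_def)
  have "[p ^ totient Y = 1] (mod Y)"
    using p pY by (intro euler_theorem) (simp add: prime_imp_coprime)
  then have "[(p ^ totient Y) ^ a = 1 ^ a] (mod Y)" by (rule cong_pow)
  then have "[p ^ (a * m) = 1] (mod Y)" by (simp add: m_def mult.commute flip: power_mult)
  then have "[int (p ^ (a * m)) = int 1] (mod int Y)" by (simp only: cong_int_iff)
  then have "int Y dvd 1 - int p ^ (a * m)" by (simp add: cong_iff_dvd_diff dvd_diff_commute)
  then have dvd: "y i dvd 1 - int p ^ (a * m)" for i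
  proof -
    have "y i dvd (\<Prod>i\<in>UNIV. y i)" by (simp add: dvd_prodI)
    then have "y i dvd int Y" by (simp add: Y_def)
    then show ?thesis using \<open>int Y dvd _\<close> by (rule dvd_trans)
  qed
  have "(1 - of_nat p ^ (a * m)) * r $ i \<in> \<nat>" for i
  proof -
    obtain q where q: "1 - int p ^ (a * m) = y i * q" using dvd[of i] by (elim dvdE)
    have y0: "y i \<noteq> 0" using xy(2)[of i] by auto
    have "(1 - of_nat p ^ (a * m)) * r $ i = of_int (1 - int p ^ (a * m)) * r $ i" by simp
    also have "\<dots> = of_int (q * x i)" unfolding q xy(1) using y0 by simp
    finally have eq: "(1 - of_nat p ^ (a * m)) * r $ i = of_int (q * x i)" .
    have "(1 - of_nat p ^ (a * m)) * r $ i \<ge> 0"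
    proof (rule mult_nonpos_nonpos)
      show "1 - (of_nat p :: rat) ^ (a * m) \<le> 0"
        using one_minus_power_neg[OF p1, of "a * m", where ?'a = rat] a m0 by simp
      show "r $ i \<le> 0" using r by (simp add: R_set_def)
    qed
    then show ?thesis unfolding eq by (simp add: Nats_altdef2 del: of_int_mult)
  qed
  then show thesis using that[OF m0] by (simp add: clears_def)
qed

section \<open>Integrality of the series\<close>

text \<open>The competitor \<open>p_frac p K W\<close> is known to be cleared at a large exponent
  \<open>K\<close> depending on \<open>l\<close>, so minimality is required over the whole fibre and
  not just among vectors cleared at \<open>c\<close>.\<close>

lemma Phi_integral:
  fixes A :: "'m::finite \<Rightarrow> int ^ 'n" and val :: "'k::field_char_0 \<Rightarrow> ereal"
  assumes p: "prime p" and val: "extends_padic_val p val" and pi: "\<pi> ^ (p - 1) = - of_nat p"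
    and v: "v \<in> R_fibre p A \<gamma>" and c: "c > 0" "clears p c v"
    and min: "\<And>r. r \<in> R_fibre p A \<gamma> \<Longrightarrow> weight p v \<le> weight p r"
  shows "0 \<le> val (Phi \<pi> A v u)"
proof (cases "\<exists>l\<in>L_at A v. u = v + rat_vec l")
  case False
  then have "{l. l \<in> L_at A v \<and> u = v + rat_vec l} = {}" by auto
  then have "Phi \<pi> A v u = 0" unfolding Phi_def by (simp only: sum.empty)
  then show ?thesis using val_zero[OF p val] by simp
next
  case True
  then obtain l where l: "l \<in> L_at A v" "u = v + rat_vec l" by auto
  have "{l. l \<in> L_at A v \<and> u = v + rat_vec l} = {l}"
    using l by (auto simp: rat_vec_def vec_eq_iff)
  then have Phi: "Phi \<pi> A v u = of_rat (minus_bracket v l / plus_bracket v l) * \<pi> powi (\<Sum>i\<in>UNIV. l $ i)"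
    unfolding Phi_def by (simp only: sum.empty sum.insert finite.emptyI) simp
  have p1: "p > 1" using prime_gt_1_nat[OF p] .
  have vR: "v \<in> R_set p" "lin_comb A v = \<gamma>" using v by (auto simp: R_fibre_def)
  have vb: "-1 \<le> v $ i \<and> v $ i \<le> 0" for i using vR by (simp add: R_set_def)
  have ns: "nsupp (v + rat_vec l) = nsupp v" "l \<in> L_set A" using l by (auto simp: L_at_def)
  \<comment> \<open>At the ends of \<open>[-1, 0]\<close> no \<open>K\<close> leaves room on both
    sides, as \<open>V $ i\<close> is \<open>0\<close> or \<open>p ^ K - 1\<close>; there
    \<open>nsupp\<close> fixes the sign of \<open>l $ i\<close>.\<close>
  have end0: "l $ i \<ge> 0" if "v $ i = 0" for i
  proof -
    have "i \<notin> nsupp (v + rat_vec l)" using ns(1) that by (simp add: nsupp_def)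
    then show ?thesis using that by (simp add: nsupp_def rat_vec_def)
  qed
  have end1: "l $ i \<le> 0" if "v $ i = -1" for i
  proof -
    have "i \<in> nsupp (v + rat_vec l)" using ns(1) that by (simp add: nsupp_def)
    then have "of_int (l $ i) < (1::rat)" using that by (simp add: nsupp_def rat_vec_def)
    then show ?thesis by simp
  qed
  text \<open>Where \<open>v\<^sub>i\<close> is \<open>0\<close> or \<open>-1\<close> the corresponding term is \<open>1 / 0 = 0\<close>, and the sign of \<open>l\<^sub>i\<close> is forced instead.\<close>
  define M where "M = (\<lambda>i. of_int \<bar>l $ i\<bar> * (1 + 1 / (- v $ i) + 1 / (1 + v $ i)))"
  \<comment> \<open>\<open>Q\<close> stands for \<open>p ^ K - 1\<close>, so that
    \<open>Q * (- v $ i)\<close> is \<open>V $ i\<close>.\<close>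
  have M: "0 \<le> Q * (- v $ i) + of_int (l $ i)" "Q * (- v $ i) + of_int (l $ i) \<le> Q"
    if Q: "Q \<ge> M i" for Q i
  proof -
    have nn: "0 \<le> 1 / (- v $ i)" "0 \<le> 1 / (1 + v $ i)" "0 \<le> rat_of_int \<bar>l $ i\<bar>"
      using vb[of i] by (auto simp: divide_simps)
    have abs: "- of_int \<bar>l $ i\<bar> \<le> rat_of_int (l $ i)" "rat_of_int (l $ i) \<le> of_int \<bar>l $ i\<bar>"
      by (simp_all add: abs_le_iff minus_le_iff flip: of_int_minus del: of_int_abs)
    have Q3: "Q \<ge> of_int \<bar>l $ i\<bar>" "Q \<ge> of_int \<bar>l $ i\<bar> * (1 / (- v $ i))" "Q \<ge> of_int \<bar>l $ i\<bar> * (1 / (1 + v $ i))"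
      using Q nn mult_nonneg_nonneg[OF nn(3,1)] mult_nonneg_nonneg[OF nn(3,2)]
      unfolding M_def distrib_left by linarith+
    show "0 \<le> Q * (- v $ i) + of_int (l $ i)"
    proof (cases "v $ i = 0")
      case True
      then show ?thesis using end0 by simp
    next
      case False
      then have "- v $ i > 0" using vb[of i] by simp
      then have "of_int \<bar>l $ i\<bar> \<le> Q * (- v $ i)" using Q3(2) by (simp add: field_simps)
      then show ?thesis using abs by linarith
    qed
    show "Q * (- v $ i) + of_int (l $ i) \<le> Q"
    proof (cases "v $ i = -1")
      case True
      then show ?thesis using end1 by simp
    next
      case False
      then have pos: "1 + v $ i > 0" using vb[of i] by simp
      then have "of_int \<bar>l $ i\<bar> \<le> Q * (1 + v $ i)" using Q3(3) by (simp add: field_simps)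
      then show ?thesis using abs unfolding distrib_left by simp
    qed
  qed
  obtain k where k: "Max (range M) + 1 < of_nat k" using reals_Archimedean2 by blast
  \<comment> \<open>A multiple of \<open>c\<close> keeps \<open>v\<close> cleared,
    \<open>Suc\<close> makes it positive, and \<open>k < p ^ K\<close> makes it large enough for
    every index.\<close>
  define K where "K = c * Suc k"
  have K0: "K > 0" using c by (simp add: K_def)
  have QM: "M i \<le> of_nat p ^ K - 1" for i
  proof -
    have "k < 2 ^ k" by (rule less_exp)
    also have "\<dots> \<le> p ^ k" using p1 by (intro power_mono) auto
    also have "\<dots> \<le> p ^ K"
    proof (rule power_increasing)
      have "1 * k \<le> c * Suc k" using c by (intro mult_mono) auto
      then show "k \<le> K" by (simp add: K_def)
    qed (use p1 in simp)
    finally have "rat_of_nat k < of_nat (p ^ K)" by (simp only: of_nat_less_iff)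
    then have "rat_of_nat k < of_nat p ^ K" by (simp only: of_nat_power)
    moreover have "M i \<le> Max (range M)" by simp
    ultimately show ?thesis using k by linarith
  qed
  have cl: "clears p K v"
    unfolding K_def using cleared_mult(1)[OF p1 c, of "Suc k"] vb by blast
  obtain V where V: "v = p_frac p K V" "\<And>i. V $ i < p ^ K"
    using p_frac_exhaust[OF p1 K0 cl vR(1)] by blast
  have Vv: "(1 - of_nat p ^ K) * v $ i = of_nat (V $ i)" for i
    unfolding V(1) by (rule p_frac_mult[OF p1 K0])
  have bd: "0 \<le> int (V $ i) + l $ i" "int (V $ i) + l $ i < int p ^ K" for i
  proof -
    have e: "(of_nat p ^ K - 1) * (- v $ i) + of_int (l $ i) = of_int (int (V $ i) + l $ i)"
      using Vv[of i] by (simp add: algebra_simps)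
    have "0 \<le> rat_of_int (int (V $ i) + l $ i)" using M(1)[OF QM[of i]] unfolding e .
    then show "0 \<le> int (V $ i) + l $ i" by (simp only: of_int_0_le_iff)
    have "rat_of_int (int (V $ i) + l $ i) \<le> of_nat p ^ K - 1" using M(2)[OF QM[of i]] unfolding e .
    also have "\<dots> < of_int (int p ^ K)" by simp
    finally show "int (V $ i) + l $ i < int p ^ K" by (simp only: of_int_less_iff)
  qed
  define W where "W = (\<chi> i. nat (int (V $ i) + l $ i))"
  have W: "int (W $ i) = int (V $ i) + l $ i" "W $ i < p ^ K" for i
    using bd[of i] by (auto simp: W_def nat_less_iff)
  have "int_comb A W = int_comb A V"
    using ns(2) by (simp add: int_comb_def L_set_def W(1) vector_sadd_rdistrib sum.distrib)
  then have "p_frac p K W \<in> R_fibre p A \<gamma>"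
    using p_frac_in_R_set[OF p1 K0 W(2)] vR(2) by (simp add: R_fibre_def V(1) lin_comb_p_frac)
  from min[OF this] have "digit_sum_vec p V \<le> digit_sum_vec p W"
    unfolding V(1) using weight_p_frac[OF p1 K0 V(2)] weight_p_frac[OF p1 K0 W(2)] K0
    by (simp add: divide_le_cancel)
  then show ?thesis
    unfolding Phi using bracket_quotient_val[OF p val K0 Vv V(2) W pi] by blast
qed

section \<open>Closed walks of small mean weight\<close>

definition closed_walk ::
    "'a set \<Rightarrow> ('a \<Rightarrow> 'e \<Rightarrow> 'a \<Rightarrow> bool) \<Rightarrow> nat \<Rightarrow> (nat \<Rightarrow> 'a) \<Rightarrow> (nat \<Rightarrow> 'e) \<Rightarrow> bool" where
  "closed_walk G E m g s \<longleftrightarrow> 0 < m \<and> g m = g 0 \<and> (\<forall>k<m. g k \<in> G \<and> E (g k) (s k) (g (Suc k)))"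

text \<open>A walk longer than \<open>card G\<close> repeats a vertex. Its mean is a weighted mean
  of those of the loop and of the rest, so one of the two is no larger.\<close>

lemma short_closed_walk:
  fixes wt :: "'e \<Rightarrow> real"
  assumes G: "finite G" and "closed_walk G E m g s"
  obtains b g' s' where "closed_walk G E b g' s'" "b \<le> card G"
    "(\<Sum>k<b. wt (s' k)) / real b \<le> (\<Sum>k<m. wt (s k)) / real m"
  using assms(2)
proof (induction m arbitrary: g s thesis rule: less_induct)
  case (less m)
  have m: "0 < m" "g m = g 0" "\<And>k. k < m \<Longrightarrow> g k \<in> G" "\<And>k. k < m \<Longrightarrow> E (g k) (s k) (g (Suc k))"
    using less.prems(2) by (auto simp: closed_walk_def)
  show ?case
  proof (cases "m \<le> card G")
    case True
    then show ?thesis using less.prems by blast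
  next
    case False
    \<comment> \<open>Pigeonhole on the first \<open>card G + 1\<close> indices, all below
      \<open>m\<close>, also bounds the length of the loop by \<open>card G\<close>.\<close>
    have "card (g ` {..card G}) \<le> card G" using m(3) False by (intro card_mono[OF G]) auto
    then have "\<not> inj_on g {..card G}" using card_image[of g "{..card G}"] by auto
    then obtain i j where ij: "i < j" "j \<le> card G" "g i = g j"
      unfolding inj_on_def by (metis atMost_iff nat_neq_iff)
    define d where "d = j - i"
    have j: "j = i + d" "0 < d" "j < m" "d < m" using ij False by (auto simp: d_def)
    have 1: "closed_walk G E d (\<lambda>k. g (i + k)) (\<lambda>k. s (i + k))"
      using m j ij by (simp add: closed_walk_def)
    define g2 where "g2 = (\<lambda>k. if k < i then g k else g (k + d))"
    define s2 where "s2 = (\<lambda>k. if k < i then s k else s (k + d))"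
    have edge: "g2 k \<in> G \<and> E (g2 k) (s2 k) (g2 (Suc k))" if "k < m - d" for k
    \<comment> \<open>This is the seam: \<open>g2 i\<close> is \<open>g j\<close>, which equals the
      vertex \<open>g i\<close> that the edge leads to.\<close>
    proof (cases "Suc k = i")
      case True
      then show ?thesis using m(3,4)[of k] that ij(3) j by (auto simp: g2_def s2_def)
    next
      case False
      then show ?thesis using m(3,4)[of k] m(3,4)[of "k + d"] that j by (auto simp: g2_def s2_def)
    qed
    have "g2 0 = g 0" using ij(3) j by (cases "i = 0") (auto simp: g2_def)
    moreover have "g2 (m - d) = g m" using j by (auto simp: g2_def)
    ultimately have 2: "closed_walk G E (m - d) g2 s2"
      using m(2) edge j by (simp add: closed_walk_def)
    define W where "W = (\<Sum>k<m. wt (s k))"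
    define W1 where "W1 = (\<Sum>k<d. wt (s (i + k)))"
    define W2 where "W2 = (\<Sum>k<m-d. wt (s2 k))"
    have W: "W = W1 + W2"
    proof -
      have "W = (\<Sum>k<i. wt (s k)) + (\<Sum>k=i..<i+d. wt (s k)) + (\<Sum>k=i+d..<m. wt (s k))"
        unfolding W_def using j
        by (simp add: sum.atLeastLessThan_concat flip: atLeast0LessThan)
      moreover have "(\<Sum>k=i..<i+d. wt (s k)) = W1"
        unfolding W1_def using sum.shift_bounds_nat_ivl[of "\<lambda>k. wt (s k)" 0 i d]
        by (simp add: atLeast0LessThan add.commute)
      moreover have "W2 = (\<Sum>k<i. wt (s k)) + (\<Sum>k=i+d..<m. wt (s k))"
      proof -
        have "W2 = (\<Sum>k=0..<i. wt (s2 k)) + (\<Sum>k=i..<m-d. wt (s2 k))"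
          unfolding W2_def using j by (simp add: sum.atLeastLessThan_concat flip: atLeast0LessThan)
        also have "(\<Sum>k=i..<m-d. wt (s2 k)) = (\<Sum>k=i..<m-d. wt (s (k + d)))"
          by (intro sum.cong) (auto simp: s2_def)
        also have "\<dots> = (\<Sum>k=i+d..<m-d+d. wt (s k))"
          by (rule sum.shift_bounds_nat_ivl[symmetric])
        finally show ?thesis using j by (simp add: s2_def atLeast0LessThan)
      qed
      ultimately show ?thesis by simp
    qed
    show ?thesis
    proof (cases "W1 / real d \<le> W / real m")
      \<comment> \<open>The loop is already short, so the induction hypothesis is needed only for
        the other part.\<close>
      case True
      then show ?thesis
        using less.prems(1)[OF 1] ij by (simp add: W_def W1_def d_def)
    next
      case False
      then have "W * real d < W1 * real m" using j m by (simp add: field_simps)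
      then have "W2 * real m \<le> W * real (m - d)" using j by (simp add: W of_nat_diff algebra_simps)
      then have le: "W2 / real (m - d) \<le> W / real m" using j m by (simp add: field_simps)
      have "m - d < m" using j m by simp
      from less.IH[OF this _ 2] obtain b g' s' where "closed_walk G E b g' s'" "b \<le> card G"
        "(\<Sum>k<b. wt (s' k)) / real b \<le> W2 / real (m - d)"
        unfolding W2_def by metis
      then show ?thesis using less.prems(1)[of b g' s'] order_trans[OF _ le] unfolding W_def by blast
    qed
  qed
qed

section \<open>Rotation of digits\<close>

text \<open>For \<open>t < q ^ m\<close> and \<open>k \<le> m\<close> the lowest \<open>k\<close> of
  the \<open>m\<close> base \<open>q\<close> digits move to the top.\<close>

definition rotate_digits :: "nat \<Rightarrow> nat \<Rightarrow> nat \<Rightarrow> nat \<Rightarrow> nat" where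
  "rotate_digits q m k t = t div q ^ k + q ^ (m - k) * (t mod q ^ k)"

lemma rotate_digits_0 [simp]: "rotate_digits q m 0 t = t"
  by (simp add: rotate_digits_def)

lemma rotate_digits_full: "t < q ^ m \<Longrightarrow> rotate_digits q m m t = t"
  by (simp add: rotate_digits_def)

text \<open>Rotation preserves the support of a vector, which later keeps the whole walk in one open
  face.\<close>

lemma rotate_digits_eq_0_iff: "q > 0 \<Longrightarrow> rotate_digits q m k t = 0 \<longleftrightarrow> t = 0"
  unfolding rotate_digits_def by (metis add_is_0 div_mult_mod_eq mult_is_0 power_not_zero
      less_not_refl div_0 mod_0 mult_0_right)

lemma rotate_digits_less:
  assumes "q > 0" "k \<le> m" "t < q ^ m"
  shows "rotate_digits q m k t < q ^ m"
proof -
  have e: "q ^ m = q ^ (m - k) * q ^ k" using assms(2) by (simp flip: power_add)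
  have "t div q ^ k < q ^ (m - k)" using assms(1,3) unfolding e by (simp add: less_mult_imp_div_less)
  then have "rotate_digits q m k t < q ^ (m - k) * Suc (t mod q ^ k)" by (simp add: rotate_digits_def)
  also have "\<dots> \<le> q ^ (m - k) * q ^ k" using assms(1) by (intro mult_left_mono) (auto simp: Suc_leI)
  finally show ?thesis unfolding e .
qed

text \<open>The lowest digit is removed, the rest divided by \<open>q\<close>, and the digit put
  back on top. Division by \<open>1 - q ^ m\<close> turns this equation into that of
  \<open>edge\<close>.\<close>

lemma rotate_digits_Suc:
  assumes "k < m"
  shows "q * rotate_digits q m (Suc k) t + t div q ^ k mod q
    = rotate_digits q m k t + q ^ m * (t div q ^ k mod q)"
proof -
  have "m - k = Suc (m - Suc k)" using assms by simp
  then have "q ^ (m - k) = q * q ^ (m - Suc k)" by simp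
  moreover have "q ^ m = q ^ (m - k) * q ^ k" using assms by (simp flip: power_add)
  ultimately have e: "q ^ m = q * q ^ (m - Suc k) * q ^ k" "q ^ (m - k) = q * q ^ (m - Suc k)"
    by simp_all
  have "t div q ^ k = q * (t div q ^ Suc k) + t div q ^ k mod q"
    by (simp add: div_mult2_eq power_Suc2 del: power_Suc)
  moreover have "t mod q ^ Suc k = q ^ k * (t div q ^ k mod q) + t mod q ^ k"
    by (simp add: mod_mult2_eq power_Suc2 del: power_Suc)
  ultimately show ?thesis unfolding rotate_digits_def e by (simp add: algebra_simps)
qed

text \<open>The bound is proved along with the digit sum because \<open>digit_sum_concat\<close>
  needs it in the induction.\<close>

lemma digit_sum_blocks:
  assumes p: "p > 1" and s: "\<And>k. k < m \<Longrightarrow> s k < p ^ a"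
  shows "(\<Sum>k<m. p ^ (a * k) * s k) < p ^ (a * m)
    \<and> digit_sum p (\<Sum>k<m. p ^ (a * k) * s k) = (\<Sum>k<m. digit_sum p (s k))"
  using s
proof (induction m)
  case 0
  then show ?case by (simp add: digit_sum_def)
next
  case (Suc m)
  then have IH: "(\<Sum>k<m. p ^ (a * k) * s k) < p ^ (a * m)"
    "digit_sum p (\<Sum>k<m. p ^ (a * k) * s k) = (\<Sum>k<m. digit_sum p (s k))" by auto
  have "(\<Sum>k<Suc m. p ^ (a * k) * s k) < p ^ (a * m) * Suc (s m)" using IH(1) by simp
  also have "\<dots> \<le> p ^ (a * m) * p ^ a" using Suc.prems[of m] by (intro mult_left_mono) auto
  finally show ?case using digit_sum_concat[OF p IH(1), of "s m"] IH(2)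
    by (simp add: power_add mult.commute)
qed

lemma sum_digit_blocks:
  fixes q t :: nat
  shows "(\<Sum>k<m. q ^ k * (t div q ^ k mod q)) = t mod q ^ m"
proof (induction m)
  case (Suc m)
  have "t mod q ^ Suc m = q ^ m * (t div q ^ m mod q) + t mod q ^ m"
    by (simp add: mod_mult2_eq power_Suc2 del: power_Suc)
  then show ?case using Suc by simp
qed simp

section \<open>From closed walks to vectors in a fibre\<close>

lemma real_vec_int_comb:
  "real_vec (int_comb A V) = (\<Sum>i\<in>UNIV. real (V $ i) *\<^sub>R real_vec (A i))"
  by (simp add: int_comb_def real_vec_def vec_eq_iff)

definition edge ::
    "nat \<Rightarrow> nat \<Rightarrow> ('m::finite \<Rightarrow> int ^ 'n) \<Rightarrow> real ^ 'n \<Rightarrow> nat ^ 'm \<Rightarrow> real ^ 'n \<Rightarrow> bool" where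
  "edge p a A x s y \<longleftrightarrow> (\<forall>i. s $ i < p ^ a) \<and> real p ^ a *\<^sub>R y = x - real_vec (int_comb A s)"

text \<open>The edge equations telescope, and \<open>g b = g 0\<close> turns the result into
  \<open>(1 - p ^ (a * b)) * g 0\<close> on one side and an integral combination on the
  other.\<close>

lemma fibre_of_walk:
  assumes p: "p > 1" and a: "a > 0" and walk: "closed_walk G (edge p a A) b g s"
  obtains v where "v \<in> R_fibre_at p A (g 0) (a * b)"
    "weight p v = (\<Sum>k<b. real (digit_sum_vec p (s k))) / real b / real a"
proof -
  have b: "b > 0" "g b = g 0" using walk by (auto simp: closed_walk_def)
  have s: "s k $ i < p ^ a" if "k < b" for k i using walk that by (simp add: closed_walk_def edge_def)
  have step: "real p ^ a *\<^sub>R g (Suc k) = g k - real_vec (int_comb A (s k))" if "k < b" for k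
    using walk that by (simp add: closed_walk_def edge_def)
  \<comment> \<open>The labels are the base \<open>p ^ a\<close> digits, the first one
    lowest.\<close>
  define V where "V = (\<lambda>m. \<chi> i. \<Sum>k<m. p ^ (a * k) * s k $ i)"
  have tele: "real p ^ (a * m) *\<^sub>R g m = g 0 - real_vec (int_comb A (V m))" if "m \<le> b" for m
    using that
  proof (induction m)
    case 0
    then show ?case by (simp add: V_def real_vec_int_comb)
  next
    case (Suc m)
    have "real_vec (int_comb A (V (Suc m)))
        = real_vec (int_comb A (V m)) + real p ^ (a * m) *\<^sub>R real_vec (int_comb A (s m))"
      unfolding real_vec_int_comb
      by (simp add: V_def scaleR_add_left sum.distrib scaleR_sum_right)
    moreover have "real p ^ (a * Suc m) *\<^sub>R g (Suc m) = real p ^ (a * m) *\<^sub>R (real p ^ a *\<^sub>R g (Suc m))"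
      by (simp add: power_add mult.commute)
    ultimately show ?case using Suc step[of m] by (simp add: scaleR_diff_right)
  qed
  have ab: "a * b > 0" using a b by simp
  have Vb: "V b $ i < p ^ (a * b)" for i
    using digit_sum_blocks[OF p, of b "\<lambda>k. s k $ i" a] s by (simp add: V_def)
  have neg: "1 - real p ^ (a * b) < 0" using one_minus_power_neg[OF p ab] .
  have "(1 - real p ^ (a * b)) *\<^sub>R g 0 = real_vec (int_comb A (V b))"
    using tele[of b] b(2) by (simp add: scaleR_diff_left)
  then have "(1 / (1 - real p ^ (a * b))) *\<^sub>R real_vec (int_comb A (V b))
      = (1 / (1 - real p ^ (a * b))) *\<^sub>R ((1 - real p ^ (a * b)) *\<^sub>R g 0)" by simp
  also have "\<dots> = g 0" using neg unfolding scaleR_scaleR by simp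
  finally have "lin_comb A (p_frac p (a * b) (V b)) = g 0" unfolding lin_comb_p_frac .
  then have "p_frac p (a * b) (V b) \<in> R_fibre_at p A (g 0) (a * b)"
    using p_frac_in_R_set[OF p ab Vb] clears_p_frac[OF p ab] by (simp add: R_fibre_at_def R_fibre_def)
  moreover have "digit_sum_vec p (V b) = (\<Sum>k<b. digit_sum_vec p (s k))"
  proof -
    have "digit_sum p (V b $ i) = (\<Sum>k<b. digit_sum p (s k $ i))" for i
      using digit_sum_blocks[OF p, of b "\<lambda>k. s k $ i" a] s by (simp add: V_def)
    then show ?thesis unfolding digit_sum_vec_def by (simp add: sum.swap[of _ "{..<b}"])
  qed
  then have "weight p (p_frac p (a * b) (V b)) = (\<Sum>k<b. real (digit_sum_vec p (s k))) / real b / real a"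
    using weight_p_frac[OF p ab Vb] by simp
  ultimately show thesis by (rule that)
qed

section \<open>Faces of the cone\<close>

lemma nonneg_comb_in_Cone:
  assumes "\<And>i. x i \<ge> 0"
  shows "(\<Sum>i\<in>UNIV. x i *\<^sub>R real_vec (A i)) \<in> Cone A"
proof -
  have cone: "convex (Cone A)" "cone (Cone A)"
    by (simp_all add: Cone_def Delta_def convex_cone_hull cone_cone_hull convex_convex_hull)
  then have add: "u + w \<in> Cone A" if "u \<in> Cone A" "w \<in> Cone A" for u w
    using that convex_cone by blast
  have 0: "0 \<in> Cone A" unfolding Cone_def Delta_def by (intro hull_inc) simp
  have mem: "x i *\<^sub>R real_vec (A i) \<in> Cone A" for i
    by (rule mem_cone[OF cone(2) _ assms]) (auto simp: Cone_def Delta_def intro!: hull_inc)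
  have "(\<Sum>i\<in>I. x i *\<^sub>R real_vec (A i)) \<in> Cone A" if "finite I" for I
    using that by (induction I rule: finite_induct) (simp_all add: 0 add mem)
  then show ?thesis by simp
qed

text \<open>Unless \<open>x = y\<close>, the point \<open>y\<close> is interior to the segment from
  \<open>x\<close> to the extension point, so a face through \<open>y\<close> contains both
  ends.\<close>

lemma face_of_extend:
  assumes F: "F face_of C" and x: "x \<in> C" and y: "y \<in> F"
    and e: "\<epsilon> > 0" "y + \<epsilon> *\<^sub>R (y - x) \<in> C"
  shows "x \<in> F \<and> y + \<epsilon> *\<^sub>R (y - x) \<in> F"
proof (cases "x = y")
  case True
  then show ?thesis using y by simp
next
  case False
  define z where "z = y + \<epsilon> *\<^sub>R (y - x)"
  have "z - x = (1 + \<epsilon>) *\<^sub>R (y - x)" by (simp add: z_def algebra_simps)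
  then have zx: "x \<noteq> z" using False e by auto
  have "(1 / (1 + \<epsilon>)) *\<^sub>R (z - x) = y - x"
    using e unfolding \<open>z - x = _\<close> scaleR_scaleR by simp
  then have "y = (1 - 1 / (1 + \<epsilon>)) *\<^sub>R x + (1 / (1 + \<epsilon>)) *\<^sub>R z"
    by (simp add: algebra_simps)
  then have "y \<in> open_segment x z"
    using zx e unfolding in_segment by (intro conjI exI[of _ "1 / (1 + \<epsilon>)"]) auto
  then show ?thesis using F x e y unfolding z_def[symmetric] face_of_def by blast
qed

text \<open>Each of the two points can be passed within \<open>C\<close> when coming from the other,
  so the same faces contain them.\<close>

lemma open_face_transfer:
  assumes C: "x \<in> C" "y \<in> C"
    and x: "x \<in> open_face (smallest_face C w)"
    and xy: "\<delta> > 0" "x + \<delta> *\<^sub>R (x - y) \<in> C" and yx: "\<epsilon> > 0" "y + \<epsilon> *\<^sub>R (y - x) \<in> C"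
  shows "y \<in> open_face (smallest_face C w)"
proof -
  define F where "F = smallest_face C w"
  have xF: "x \<in> F" using x by (simp add: open_face_def F_def)
  have yF: "y \<in> F"
    using xF face_of_extend[OF _ C(2) _ xy] unfolding F_def smallest_face_def by blast
  \<comment> \<open>The faces \<open>G\<close> below are faces of \<open>F\<close> rather than of
    \<open>C\<close>, so the extension point must first be placed in \<open>F\<close>.\<close>
  have zF: "y + \<epsilon> *\<^sub>R (y - x) \<in> F"
    using yF face_of_extend[OF _ C(1) _ yx] unfolding F_def smallest_face_def by blast
  have "x \<in> G" if "G face_of F" "y \<in> G" for G
    using face_of_extend[OF that(1) xF that(2) yx(1) zF] by blast
  then show ?thesis using x yF unfolding open_face_def F_def[symmetric] by blast
qed

text \<open>In coefficients this is the extension hypothesis of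
  \<open>open_face_transfer\<close>.\<close>

lemma nonneg_extend:
  fixes x y :: "'m::finite \<Rightarrow> real"
  assumes "\<And>i. x i \<ge> 0" "\<And>i. y i \<ge> 0" "\<And>i. x i = 0 \<Longrightarrow> y i = 0"
  obtains \<epsilon> where "\<epsilon> > 0" "\<And>i. x i + \<epsilon> * (x i - y i) \<ge> 0"
proof -
  \<comment> \<open>\<open>D\<close> bounds every quotient \<open>y i / x i\<close>, with
    \<open>y i / 0 = 0\<close> by convention; \<open>1 / (1 + D)\<close> is then a small enough
    step.\<close>
  define D where "D = (\<Sum>i\<in>UNIV. y i / x i)"
  have D: "y i / x i \<le> D" for i
    unfolding D_def using assms by (intro member_le_sum) auto
  have D0: "D \<ge> 0" unfolding D_def using assms by (intro sum_nonneg) auto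
  have "x i + 1 / (1 + D) * (x i - y i) \<ge> 0" for i
  proof (cases "x i = 0")
    case True
    then show ?thesis using assms(3) by simp
  next
    case False
    then have "y i \<le> D * x i" using D[of i] assms(1)[of i] by (simp add: pos_divide_le_eq less_le)
    then have "y i \<le> (1 + D) * x i + x i" using assms(1)[of i] by (simp add: algebra_simps)
    then show ?thesis using D0 by (simp add: field_simps)
  qed
  then show thesis using that[of "1 / (1 + D)"] D0 by simp
qed

section \<open>From vectors in a fibre to walks\<close>

text \<open>The vertices come from the rotations \<open>U k\<close> of \<open>V\<close>. Membership
  in the coset, in \<open>RA\<close> and in the open face is checked separately.\<close>

lemma walk_of_fibre:
  assumes p: "p > 1" and a: "a > 0" and \<beta>: "(real p ^ a - 1) *\<^sub>R \<beta> = real_vec z"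
    and \<gamma>: "\<gamma> \<in> Gamma_set p A \<beta>"
    and m: "m > 0" and r: "r \<in> R_fibre p A \<gamma>" "clears p (a * m) r"
  obtains g s where "closed_walk (Gamma_set p A \<beta>) (edge p a A) m g s"
    "weight p r = (\<Sum>k<m. real (digit_sum_vec p (s k))) / real m / real a"
proof -
  define q where "q = p ^ a"
  have q: "q > 0" "q ^ k = p ^ (a * k)" for k using p by (simp_all add: q_def power_mult)
  have am: "a * m > 0" using a m by simp
  have rR: "r \<in> R_set p" "lin_comb A r = \<gamma>" using r by (auto simp: R_fibre_def)
  obtain V where V: "r = p_frac p (a * m) V" "\<And>i. V $ i < p ^ (a * m)"
    using p_frac_exhaust[OF p am r(2) rR(1)] by blast
  define U where "U = (\<lambda>k. \<chi> i. rotate_digits q m k (V $ i))"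
  define g where "g = (\<lambda>k. lin_comb A (p_frac p (a * m) (U k)))"
  define s where "s = (\<lambda>k. \<chi> i. V $ i div q ^ k mod q)"
  have U0: "U 0 = V" by (simp add: U_def vec_eq_iff)
  have Um: "U m = V" using V(2) by (simp add: U_def vec_eq_iff rotate_digits_full q(2))
  have Ub: "U k $ i < p ^ (a * m)" if "k \<le> m" for k i
    using rotate_digits_less[OF q(1) that] V(2) by (simp add: U_def q(2))
  have g0: "g 0 = \<gamma>" "g m = \<gamma>" using rR(2) by (simp_all add: g_def U0 Um V(1))
  have neg: "1 - real p ^ (a * m) < 0" using one_minus_power_neg[OF p am] .
  have edge: "edge p a A (g k) (s k) (g (Suc k))" if "k < m" for k
  proof -
    have "real q * real (U (Suc k) $ i)
        = real (U k $ i) - (1 - real p ^ (a * m)) * real (s k $ i)" for i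
    proof -
      have "real (q * U (Suc k) $ i + s k $ i) = real (U k $ i + q ^ m * s k $ i)"
        using rotate_digits_Suc[OF that, of q "V $ i"] by (simp add: U_def s_def)
      then show ?thesis unfolding q(2) by (simp add: algebra_simps)
    qed
    then have "real q *\<^sub>R real_vec (int_comb A (U (Suc k)))
        = real_vec (int_comb A (U k)) - (1 - real p ^ (a * m)) *\<^sub>R real_vec (int_comb A (s k))"
      unfolding real_vec_int_comb scaleR_sum_right scaleR_scaleR sum_subtractf[symmetric]
      by (simp only: scaleR_diff_left)
    then have "(1 / (1 - real p ^ (a * m))) *\<^sub>R (real q *\<^sub>R real_vec (int_comb A (U (Suc k))))
        = (1 / (1 - real p ^ (a * m))) *\<^sub>R (real_vec (int_comb A (U k)) - (1 - real p ^ (a * m)) *\<^sub>R real_vec (int_comb A (s k)))"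
      by simp
    then have "real q *\<^sub>R g (Suc k) = g k - real_vec (int_comb A (s k))"
      using neg unfolding g_def lin_comb_p_frac by (simp add: scaleR_diff_right mult.commute)
    then show ?thesis using q(1) by (simp add: edge_def s_def q_def)
  qed
  text \<open>Backwards along the walk, starting from its end \<open>g m = \<gamma>\<close>, no division by \<open>p\<^sup>a\<close> occurs.\<close>
  have coset: "\<exists>y. g k = \<beta> + real_vec y" if "k \<le> m" for k
    using that
  proof (induction k rule: inc_induct)
    case base
    then show ?case using \<gamma> g0 by (auto simp: Gamma_set_def)
  next
    case (step k)
    then obtain y where "g (Suc k) = \<beta> + real_vec y" by blast
    \<comment> \<open>The multiple \<open>p ^ a * \<beta>\<close> is split so that the integrality
      of \<open>(p ^ a - 1) * \<beta>\<close> brings it back into the coset of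
      \<open>\<beta>\<close>.\<close>
    then have "g k = \<beta> + (real p ^ a - 1) *\<^sub>R \<beta> + real p ^ a *\<^sub>R real_vec y + real_vec (int_comb A (s k))"
      using edge[OF step(2)] by (simp add: edge_def algebra_simps)
    also have "\<dots> = \<beta> + real_vec (z + (\<chi> j. int p ^ a * y $ j) + int_comb A (s k))"
      unfolding \<beta> by (simp add: real_vec_def vec_eq_iff)
    finally show ?case by blast
  qed
  have RA: "g k \<in> RA p A" if "k \<le> m" for k
    unfolding RA_def g_def using p_frac_in_R_set[OF p am Ub[OF that]] by blast
  define X where "X = (\<lambda>k i. 1 / (real p ^ (a * m) - 1) * real (U k $ i))"
  have X0: "X k i \<ge> 0" for k i using neg by (simp add: X_def)
  have neg_comb: "- g k = (\<Sum>i\<in>UNIV. X k i *\<^sub>R real_vec (A i))" for k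
  proof -
    have "- (1 / (1 - real p ^ (a * m))) = 1 / (real p ^ (a * m) - 1)"
      by (metis minus_diff_eq minus_divide_right)
    then have "- g k = (1 / (real p ^ (a * m) - 1)) *\<^sub>R real_vec (int_comb A (U k))"
      unfolding g_def lin_comb_p_frac by (metis scaleR_minus_left)
    then show ?thesis unfolding real_vec_int_comb scaleR_sum_right scaleR_scaleR X_def .
  qed
  \<comment> \<open>All \<open>U k\<close> have the same support, so any two points of the walk can
    be continued past each other inside the cone.\<close>
  have extend: "\<exists>\<epsilon>>0. - g k + \<epsilon> *\<^sub>R (- g k - - g l) \<in> Cone A" for k l
  proof -
    have "U k $ i = 0 \<longleftrightarrow> U l $ i = 0" for i
      using rotate_digits_eq_0_iff[OF q(1)] by (simp add: U_def)
    then have "X l i = 0" if "X k i = 0" for i using that neg by (simp add: X_def)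
    then obtain \<epsilon> where e: "\<epsilon> > 0" "\<And>i. X k i + \<epsilon> * (X k i - X l i) \<ge> 0"
      using nonneg_extend[of "X k" "X l"] X0 by blast
    have "- g k + \<epsilon> *\<^sub>R (- g k - - g l) \<in> Cone A"
      using nonneg_comb_in_Cone[where A = A, OF e(2)] unfolding neg_comb
      by (simp add: scaleR_add_left scaleR_diff_left sum.distrib sum_subtractf scaleR_sum_right
          right_diff_distrib scaleR_diff_right)
    then show ?thesis using e(1) by blast
  qed
  have inC: "- g k \<in> Cone A" for k
    unfolding neg_comb using X0 by (rule nonneg_comb_in_Cone)
  have "\<gamma> \<in> uminus ` open_face (smallest_face (Cone A) (- \<beta>))"
    using \<gamma> by (simp add: Gamma_set_def)
  then have "- \<gamma> \<in> open_face (smallest_face (Cone A) (- \<beta>))" by (elim imageE) simp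
  then have face: "- g k \<in> open_face (smallest_face (Cone A) (- \<beta>))" for k
    using open_face_transfer[OF inC[of 0] inC[of k]] extend[of 0 k] extend[of k 0] g0 by metis
  have "g k \<in> Gamma_set p A \<beta>" if "k < m" for k
    unfolding Gamma_set_def using face[of k] coset[of k] RA[of k] that
    by (auto intro!: image_eqI[of _ _ "- g k"])
  then have "closed_walk (Gamma_set p A \<beta>) (edge p a A) m g s"
    using m g0 edge by (simp add: closed_walk_def)
  moreover have "digit_sum_vec p V = (\<Sum>k<m. digit_sum_vec p (s k))"
  proof -
    have "digit_sum p (V $ i) = (\<Sum>k<m. digit_sum p (s k $ i))" for i
      using digit_sum_blocks[OF p, of m "\<lambda>k. s k $ i" a] sum_digit_blocks[of q "V $ i" m] V(2)[of i] q(1)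
      by (simp add: s_def q(2)) (simp add: q_def)
    then show ?thesis unfolding digit_sum_vec_def by (simp add: sum.swap[of _ "{..<m}"])
  qed
  then have "weight p r = (\<Sum>k<m. real (digit_sum_vec p (s k))) / real m / real a"
    unfolding V(1) using weight_p_frac[OF p am V(2)] by simp
  ultimately show thesis by (rule that)
qed

section \<open>The minimal weight\<close>

theorem theorem6p1:
  fixes p a :: nat
    and A :: "'m::finite \<Rightarrow> int ^ 'n"
    and \<beta> :: "real ^ 'n"
    and val :: "'k::{alg_closed_field, field_char_0} \<Rightarrow> ereal"
    and \<pi> :: 'k
  assumes "prime p"
    and "padic_alg_closure p val"
    and "\<pi> ^ (p - 1) = - of_nat p"
    and "- \<beta> \<in> Cone A"
    and "Gamma_set p A \<beta> \<noteq> {}"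
    and "0 < a"
    and "\<exists>z. (real p ^ a - 1) *\<^sub>R \<beta> = real_vec z"
  shows "\<exists>\<gamma> \<in> Gamma_set p A \<beta>. \<exists>b. 0 < b \<and> b \<le> card (Gamma_set p A \<beta>) \<and>
    (\<exists>v \<in> R_fibre_at p A \<gamma> (a * b).
       ereal (weight p v) = w_fibre_at p A \<gamma> (a * b) \<and>
       w_fibre_at p A \<gamma> (a * b) = w_fibre p A \<gamma> \<and>
       w_fibre p A \<gamma> = Min (w_fibre p A ` Gamma_set p A \<beta>) \<and>
       (\<forall>u. 0 \<le> val (Phi \<pi> A v u)))"
proof -
  define G where "G = Gamma_set p A \<beta>"
  have p1: "p > 1" using prime_gt_1_nat[OF assms(1)] .
  have finG: "finite G" unfolding G_def by (rule finite_Gamma_set)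
  obtain z where z: "(real p ^ a - 1) *\<^sub>R \<beta> = real_vec z" using assms(7) by blast
  \<comment> \<open>A finite pool of candidates: it suffices that every vector in a fibre over
    \<open>G\<close> is matched or beaten by a member of \<open>S\<close>.\<close>
  define S where "S = (\<Union>\<gamma>\<in>G. \<Union>b\<in>{1..card G}. R_fibre_at p A \<gamma> (a * b))"
  have "finite (R_fibre_at p A \<gamma> (a * b))" if "b \<in> {1..card G}" for \<gamma> b
    using that assms(6) by (intro finite_R_fibre_at p1) auto
  then have finS: "finite S" unfolding S_def using finG by blast
  have below: "\<exists>v\<in>S. weight p v \<le> weight p r" if d: "\<delta> \<in> G" "r \<in> R_fibre p A \<delta>" for \<delta> r
  proof -
    have "r \<in> R_set p" using d by (simp add: R_fibre_def)
    then obtain m where m: "m > 0" "clears p (a * m) r" using R_set_clears[OF assms(1) _ assms(6)] by blast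
    obtain g s where gs: "closed_walk G (edge p a A) m g s"
      "weight p r = (\<Sum>k<m. real (digit_sum_vec p (s k))) / real m / real a"
      using walk_of_fibre[OF p1 assms(6) z _ m(1) d(2) m(2)] d(1) unfolding G_def by blast
    obtain b g' s' where b: "closed_walk G (edge p a A) b g' s'" "b \<le> card G"
      "(\<Sum>k<b. real (digit_sum_vec p (s' k))) / real b \<le> (\<Sum>k<m. real (digit_sum_vec p (s k))) / real m"
      using short_closed_walk[OF finG gs(1)] .
    obtain v where v: "v \<in> R_fibre_at p A (g' 0) (a * b)"
      "weight p v = (\<Sum>k<b. real (digit_sum_vec p (s' k))) / real b / real a"
      using fibre_of_walk[OF p1 assms(6) b(1)] .
    \<comment> \<open>The short walk may start at a vertex other than \<open>\<delta>\<close>, which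
      is why \<open>S\<close> collects the fibres over all of \<open>G\<close>.\<close>
    have "0 < b" "g' 0 \<in> G" using b(1) by (auto simp: closed_walk_def)
    then have "v \<in> S" unfolding S_def using v(1) b(2) by (intro UN_I[of "g' 0"] UN_I[of b]) auto
    moreover have "weight p v \<le> weight p r" unfolding v(2) gs(2) using b(3) by (intro divide_right_mono) auto
    ultimately show ?thesis by blast
  qed
  obtain \<delta> where \<delta>: "\<delta> \<in> G" using assms(5) unfolding G_def by blast
  then have "\<delta> \<in> RA p A" by (simp add: G_def Gamma_set_def)
  then obtain r where "r \<in> R_fibre p A \<delta>" by (auto simp: RA_def R_fibre_def)
  then have "S \<noteq> {}" using below[OF \<delta>] by blast
  then obtain v where vS: "v \<in> S" and vmin: "\<And>v'. v' \<in> S \<Longrightarrow> weight p v \<le> weight p v'"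
    using finS arg_min_if_finite[of S "weight p"] by (metis not_less)
  from vS obtain \<gamma> b where \<gamma>: "\<gamma> \<in> G" and b: "0 < b" "b \<le> card G" and v: "v \<in> R_fibre_at p A \<gamma> (a * b)"
    unfolding S_def by (auto simp: Suc_le_eq)
  have vle: "weight p v \<le> weight p r" if "\<delta> \<in> G" "r \<in> R_fibre p A \<delta>" for \<delta> r
    using below[OF that] vmin by force
  have vf: "v \<in> R_fibre p A \<gamma>" "clears p (a * b) v" using v by (auto simp: R_fibre_at_def)
  have lower: "ereal (weight p v) \<le> w_fibre p A \<delta>" if "\<delta> \<in> G" for \<delta>
    unfolding w_fibre_def using vle[OF that] by (intro INF_greatest) simp
  have fib: "w_fibre p A \<gamma> = ereal (weight p v)"
    using lower[OF \<gamma>] INF_lower[OF vf(1), of "\<lambda>r. ereal (weight p r)"]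
    by (simp add: w_fibre_def antisym)
  have ab: "a * b > 0" using assms(6) b by simp
  have "Min ((\<lambda>r. ereal (weight p r)) ` R_fibre_at p A \<gamma> (a * b)) = ereal (weight p v)"
    using v vle[OF \<gamma>] finite_R_fibre_at[OF p1 ab, of A \<gamma>] by (intro Min_eqI) (auto simp: R_fibre_at_def)
  then have fibat: "w_fibre_at p A \<gamma> (a * b) = ereal (weight p v)"
    using v by (auto simp: w_fibre_at_def)
  have Min: "Min (w_fibre p A ` G) = w_fibre p A \<gamma>"
  proof (rule Min_eqI)
    show "w_fibre p A \<gamma> \<le> y" if "y \<in> w_fibre p A ` G" for y using that lower fib by auto
  qed (use finG \<gamma> in auto)
  have "0 \<le> val (Phi \<pi> A v u)" for u
    using assms(2,3) vle[OF \<gamma>] unfolding padic_alg_closure_def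
    by (intro Phi_integral[OF assms(1) _ _ vf(1) ab vf(2)]) auto
  then show ?thesis
    using \<gamma> b v fib fibat Min unfolding G_def by (intro bexI[of _ \<gamma>] exI[of _ b] conjI bexI[of _ v]) auto
qed

end
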